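(* Let $A=(a_{kl})_{k,l\in\mathbb{Z}^d}$ be a complex matrix over the index set $\mathbb{Z}^d$. Assume that for some $0<p_0\le 1$ there exists a sequence $h\in\ell^{p_0}(\mathbb{Z}^d)$ such that $|a_{kl}|\le h(k-l)$ for all $k,l\in\mathbb{Z}^d$. Then: (i) (Spectral invariance) If $A$ is invertible on $\ell^p(\mathbb{Z}^d)$ for some $p\in[p_0,\infty]$, then $A$ is invertible on $\ell^q(\mathbb{Z}^d)$ for all $q\in[p_0,\infty]$. (ii) (Spectral stability) If for some $p\in[p_0,\infty]$ there is a constant $C>0$ such that $\|Ac\|_p\ge C\|c\|_p$ for all $c\in\ell^p(\mathbb{Z}^d)$, then for every $q\in[p_0,\infty]$ there is a constant $C_q>0$ such that $\|Ac\|_q\ge C_q\|c\|_q$ for all $c\in\ell^q(\mathbb{Z}^d)$.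
   Context: For $0<p\le\infty$, $\ell^p(\mathbb{Z}^d)$ is the (quasi-)Banach space of complex sequences with $\|c\|_p=(\sum_k|c_k|^p)^{1/p}<\infty$ (supremum if $p=\infty$). The matrix acts by $(Ac)_k=\sum_{l}a_{kl}c_l$; under the stated hypothesis this series converges absolutely for $c\in\ell^\infty$ and $A$ is bounded on $\ell^q(\mathbb{Z}^d)$ for all $q\in[p_0,\infty]$. "Invertible on $\ell^p$" means bijective with bounded inverse on $\ell^p$. *)

theory Defs
  imports "HOL-Analysis.Analysis"
begin

text \<open>Exponents live in \<^typ>\<open>ereal\<close> so that the value \<open>\<infinity>\<close> is available; only \<open>0 < p\<close> is meaningful.
  Sequences are indexed by an arbitrary type, and their values may be real or complex.\<close>

definition lp_space :: "ereal \<Rightarrow> ('i \<Rightarrow> 'b::real_normed_vector) set" where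
  "lp_space p =
    (if p = \<infinity> then {c. bounded (range c)}
     else {c. (\<lambda>k. norm (c k) powr real_of_ereal p) summable_on UNIV})"

text \<open>Only a quasi-norm for \<open>p < 1\<close>. It is real-valued and hence carries no information
  about sequences outside \<^term>\<open>lp_space p\<close>.\<close>

definition lp_norm :: "ereal \<Rightarrow> ('i \<Rightarrow> 'b::real_normed_vector) \<Rightarrow> real" where
  "lp_norm p c =
    (if p = \<infinity> then (SUP k. norm (c k))
     else (\<Sum>\<^sub>\<infinity>k. norm (c k) powr real_of_ereal p) powr (1 / real_of_ereal p))"

text \<open>The infinite sum is unordered, which for complex series amounts to absolute convergence.\<close>

definition mat_apply :: "('i \<Rightarrow> 'i \<Rightarrow> complex) \<Rightarrow> ('i \<Rightarrow> complex) \<Rightarrow> 'i \<Rightarrow> complex" where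
  "mat_apply a c = (\<lambda>k. \<Sum>\<^sub>\<infinity>l. a k l * c l)"

definition lp_bounded :: "ereal \<Rightarrow> (('i \<Rightarrow> complex) \<Rightarrow> 'i \<Rightarrow> complex) \<Rightarrow> bool" where
  "lp_bounded p T \<longleftrightarrow>
    (\<forall>c\<in>lp_space p. T c \<in> lp_space p) \<and>
    (\<exists>C. \<forall>c\<in>lp_space p. lp_norm p (T c) \<le> C * lp_norm p c)"

definition lp_invertible :: "ereal \<Rightarrow> (('i \<Rightarrow> complex) \<Rightarrow> 'i \<Rightarrow> complex) \<Rightarrow> bool" where
  "lp_invertible p T \<longleftrightarrow>
    bij_betw T (lp_space p) (lp_space p) \<and> lp_bounded p (inv_into (lp_space p) T)"

end

theory Submission
  imports Defs
begin

text \<open>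
  Both parts of the theorem follow from one pointwise estimate. Put \<open>r = min 1 p\<close>. If \<open>A\<close> is bounded
  below on \<open>\<ell>\<^sup>p\<close>, then there is a nonnegative kernel \<open>v\<close> with \<open>v\<^sup>1\<^sup>/\<^sup>r \<in> \<ell>\<^sup>p\<^sup>0\<close> such that
  \<open>\<bar>c\<bar>\<^sup>r \<le> v * \<bar>A c\<bar>\<^sup>r\<close> holds pointwise for every bounded sequence \<open>c\<close>
  (\<open>lower_bound_imp_pointwise_bound\<close>). This estimate no longer mentions \<open>p\<close> as the exponent of a norm.

  \<^emph>\<open>Why the pointwise estimate holds.\<close> Multiply \<open>c\<close> by a cut-off function \<open>\<psi>\<^sub>k\<close> around \<open>k\<close> that varies at
  scale \<open>N\<close>. The product \<open>\<psi>\<^sub>k c\<close> is finitely supported, so the lower bound on \<open>\<ell>\<^sup>p\<close> applies to it, whatever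
  \<open>c\<close> is, and \<open>A (\<psi>\<^sub>k c)\<close> differs from \<open>\<psi>\<^sub>k (A c)\<close> only by the commutator \<open>[A, \<psi>\<^sub>k] c\<close>. Splitting the commutator
  into its diagonals, the \<open>s\<close>-th diagonal carries the factor \<open>h s * min 1 (\<bar>s\<bar> / N)\<close>, and it only sees \<open>c\<close>
  inside windows of size \<open>2 N\<close> around \<open>k\<close> and \<open>k - s\<close>, each of which is covered by \<open>2\<^sup>d\<close> windows of
  size \<open>N\<close>. With \<open>X k = \<parallel>\<psi>\<^sub>k c\<parallel>\<^sup>r\<close> and \<open>Z k = \<parallel>\<psi>\<^sub>k (A c)\<parallel>\<^sup>r\<close> this gives \<open>X \<le> K Z + G * X\<close>
  (\<open>local_mass_commutator\<close>), where \<open>K\<close> comes from the lower bound and \<open>G\<close> is as small as desired in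
  \<open>\<ell>\<^sup>p\<^sup>0\<^sup>/\<^sup>r\<close> once \<open>N\<close> is large, by dominated convergence (\<open>infsum_damped_small\<close>). The Neumann series of
  \<open>G\<close> for convolution converges in \<open>\<ell>\<^sup>p\<^sup>0\<^sup>/\<^sup>r\<close> and solves this inequality
  (\<open>neumann_series_domination\<close>), which yields \<open>v\<close>.

  \<^emph>\<open>Stability.\<close> For \<open>q \<ge> p\<^sub>0\<close> Young's inequality with exponent \<open>q / r\<close> turns the pointwise estimate into
  \<open>\<parallel>c\<parallel>\<^sub>q \<le> const * \<parallel>A c\<parallel>\<^sub>q\<close> (\<open>pointwise_bound_imp_lower_bound\<close>).

  \<^emph>\<open>Invertibility.\<close> If \<open>A\<close> is invertible on \<open>\<ell>\<^sup>p\<close>, let the \<open>l\<close>-th column of a matrix \<open>B\<close> be the preimage of the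
  \<open>l\<close>-th unit vector. The pointwise estimate applied to this column reads
  \<open>\<bar>B k l\<bar> \<le> v (k - l)\<^sup>1\<^sup>/\<^sup>r\<close>, so \<open>B\<close> is again dominated by convolution with an element of \<open>\<ell>\<^sup>p\<^sup>0\<close>
  (\<open>inverse_kernel\<close>). Hence \<open>B\<close> acts on every \<open>\<ell>\<^sup>q\<close> and is a right inverse of \<open>A\<close> there, while injectivity
  and the bound on the inverse come from stability (\<open>lp_invertibleI\<close>).

  The ranges \<open>p < 1\<close>, \<open>1 \<le> p < \<infinity>\<close> and \<open>p = \<infinity>\<close> are treated together: the \<open>r\<close>-th power of the (quasi-)norm
  is countably subadditive in all three (\<open>lp_mass_subadditive\<close>), and everything else about \<open>\<ell>\<^sup>p\<close>, including
  Young's inequality, is derived from that.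
\<close>

section \<open>Inequalities for powers and their sums\<close>

lemma powr_add_le_add_powr:
  fixes a b p :: real
  assumes "0 \<le> a" "0 \<le> b" "0 < p" "p \<le> 1"
  shows "(a + b) powr p \<le> a powr p + b powr p"
proof (cases "a + b = 0")
  case True
  then show ?thesis using assms by simp
next
  case False
  then have s: "a + b > 0" using assms by linarith
  have *: "x / (a + b) \<le> (x / (a + b)) powr p" if "0 \<le> x" "x \<le> a + b" for x
  proof (cases "x = 0")
    case False
    then show ?thesis
      using powr_mono'[of p 1 "x / (a + b)"] that s assms by simp
  qed simp
  have "1 = a / (a + b) + b / (a + b)" using s by (simp flip: add_divide_distrib)
  also have "\<dots> \<le> (a / (a + b)) powr p + (b / (a + b)) powr p"
    using *[of a] *[of b] assms by linarith
  also have "\<dots> = (a powr p + b powr p) / (a + b) powr p"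
    using assms s by (simp add: powr_divide add_divide_distrib)
  finally show ?thesis using s by (simp add: field_simps)
qed

text \<open>If one of the two points is the end point \<open>0\<close>, convexity comes down to \<open>t powr p \<le> t\<close> for \<open>t\<close> in the
  unit interval.\<close>
lemma convex_on_powr_atLeast_0: 
  fixes p :: real
  assumes "1 \<le> p" 
  shows "convex_on {0..} (\<lambda>x. x powr p)"
proof (rule convex_onI)
  fix t x y :: real
  assume t: "0 < t" "t < 1" and "x \<in> {0..}" "y \<in> {0..}"
  then have xy: "x \<ge> 0" "y \<ge> 0" by auto
  have small: "t' powr p \<le> t'" if "0 < t'" "t' < 1" for t' :: real
    using powr_mono'[of 1 p t'] that assms by simp
  have *: "((1 - t) * x + t * y) powr p \<le> (1 - t) * x powr p + t * y powr p"
  proof (cases "x = 0 \<or> y = 0")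
    case True
    have "(t * y) powr p \<le> t * y powr p" "((1 - t) * x) powr p \<le> (1 - t) * x powr p"
      using t xy small[of t] small[of "1 - t"] by (auto simp: powr_mult intro!: mult_right_mono)
    with True show ?thesis using assms by auto
  next
    case False
    then have "x \<in> {0<..}" "y \<in> {0<..}" using xy by auto
    from convex_onD[OF powr_convex[OF assms] _ _ this, of t] t show ?thesis by simp
  qed
  then show "((1 - t) *\<^sub>R x + t *\<^sub>R y) powr p \<le> (1 - t) * x powr p + t * y powr p"
    by simp
qed simp

text \<open>Minkowski's inequality. Scaling both functions to norm one makes it an instance of the convexity of
  \<open>x powr p\<close>.\<close>
lemma minkowski_sum_powr:
  fixes f g :: "'i \<Rightarrow> real"
  assumes K: "finite K" and f: "\<And>k. 0 \<le> f k" and g: "\<And>k. 0 \<le> g k" and p: "1 \<le> p"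
  shows "(\<Sum>k\<in>K. (f k + g k) powr p) powr (1 / p)
           \<le> (\<Sum>k\<in>K. f k powr p) powr (1 / p) + (\<Sum>k\<in>K. g k powr p) powr (1 / p)"
    (is "_ \<le> ?a + ?b")
proof -
  have zero: "h k = 0" if "(\<Sum>k\<in>K. h k powr p) powr (1 / p) = 0" "k \<in> K" "\<And>k. 0 \<le> h k" 
    for h :: "'i \<Rightarrow> real" and k
    using that K by (auto simp: sum_nonneg_eq_0_iff)
  \<comment> \<open>The scaling needs nonzero norms; if one of them vanishes, so does the function on \<open>K\<close>.\<close>
  consider "?a = 0" | "?b = 0" | "?a > 0" "?b > 0"
    by (metis powr_ge_zero less_le)
  then show ?thesis
  proof cases
    case 1
    have "(\<Sum>k\<in>K. (f k + g k) powr p) = (\<Sum>k\<in>K. g k powr p)"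
      using zero[OF 1 _ f] by (intro sum.cong) auto
    then show ?thesis by simp
  next
    case 2
    have "(\<Sum>k\<in>K. (f k + g k) powr p) = (\<Sum>k\<in>K. f k powr p)"
      using zero[OF 2 _ g] by (intro sum.cong) auto
    then show ?thesis by simp
  next
    case 3
    define a b where "a = ?a" and "b = ?b"
    have ab: "a > 0" "b > 0" using 3 by (auto simp: a_def b_def)
    define t where "t = b / (a + b)"
    have t: "0 \<le> t" "t \<le> 1" "1 - t = a / (a + b)" using ab by (auto simp: t_def field_simps)
    have ap: "a powr p = (\<Sum>k\<in>K. f k powr p)" and bp: "b powr p = (\<Sum>k\<in>K. g k powr p)"
      using p f g by (simp_all add: a_def b_def powr_powr sum_nonneg)
    have "(f k + g k) powr p 
            \<le> (a + b) powr p * ((1 - t) * (f k powr p / a powr p) + t * (g k powr p / b powr p))" for k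
    proof -
      have eq: "f k + g k = (a + b) * ((1 - t) * (f k / a) + t * (g k / b))"
        proof -
        have "(a + b) * (1 - t) = a" "(a + b) * t = b" using ab by (simp_all add: t(3), simp add: t_def)
        then show ?thesis using ab by (simp add: distrib_left flip: mult.assoc)
      qed
      have "((1 - t) * (f k / a) + t * (g k / b)) powr p \<le> (1 - t) * (f k / a) powr p + t * (g k / b) powr p"
        using convex_onD[OF convex_on_powr_atLeast_0[OF p], of t "f k / a" "g k / b"] t ab f g by simp
      then have "(a + b) powr p * ((1 - t) * (f k / a) + t * (g k / b)) powr p
              \<le> (a + b) powr p * ((1 - t) * (f k / a) powr p + t * (g k / b) powr p)"
        by (intro mult_left_mono) auto
      then show ?thesis
        unfolding eq using ab f g t by (simp add: powr_mult powr_divide)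
    qed
    then have "(\<Sum>k\<in>K. (f k + g k) powr p) \<le> 
      (\<Sum>k\<in>K. (a + b) powr p * ((1 - t) * (f k powr p / a powr p) + t * (g k powr p / b powr p)))"
      by (rule sum_mono)
    also have "\<dots> = (a + b) powr p * ((1 - t) * ((\<Sum>k\<in>K. f k powr p) / a powr p) 
                      + t * ((\<Sum>k\<in>K. g k powr p) / b powr p))"
      by (simp only: sum_distrib_left[symmetric] sum.distrib sum_divide_distrib[symmetric])
    also have "\<dots> = (a + b) powr p"
      unfolding ap[symmetric] bp[symmetric] using ab by simp
    finally have "(\<Sum>k\<in>K. (f k + g k) powr p) powr (1 / p) \<le> ((a + b) powr p) powr (1 / p)"
      using p by (intro powr_mono2) (auto simp: sum_nonneg)
    also have "\<dots> = a + b" using ab p by (simp add: powr_powr)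
    finally show ?thesis by (simp add: a_def b_def)
  qed
qed

text \<open>For \<open>p \<le> 1\<close> the outer exponent is \<open>1\<close> and the terms are subadditive one by one; for \<open>p \<ge> 1\<close> it is
  \<open>1 / p\<close> and this is Minkowski's inequality. The exponent \<open>min 1 p / p\<close> lets both cases share one form.\<close>
lemma sum_powr_subadditive:
  fixes f :: "'j \<Rightarrow> 'i \<Rightarrow> real"
  assumes K: "finite K" and J: "finite J" and f: "\<And>j k. 0 \<le> f j k" and p: "0 < p"
  shows "(\<Sum>k\<in>K. (\<Sum>j\<in>J. f j k) powr p) powr (min 1 p / p)
           \<le> (\<Sum>j\<in>J. (\<Sum>k\<in>K. f j k powr p) powr (min 1 p / p))"
  using J
proof (induction J)
  case empty
  then show ?case using p by simp
next
  case (insert i J)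
  have two: "(\<Sum>k\<in>K. (u k + v k) powr p) powr (min 1 p / p)
      \<le> (\<Sum>k\<in>K. u k powr p) powr (min 1 p / p) + (\<Sum>k\<in>K. v k powr p) powr (min 1 p / p)"
    if u: "\<And>k. 0 \<le> u k" and v: "\<And>k. 0 \<le> v k" for u v :: "'i \<Rightarrow> real"
  proof (cases "p \<le> 1")
    case True
    have "(\<Sum>k\<in>K. (u k + v k) powr p) \<le> (\<Sum>k\<in>K. u k powr p + v k powr p)"
      using True p u v by (intro sum_mono powr_add_le_add_powr) auto
    with True p show ?thesis by (simp add: sum.distrib sum_nonneg)
  next
    case False
    then show ?thesis using minkowski_sum_powr[OF K u v, of p] by simp
  qed
  show ?case
    using two[of "f i" "\<lambda>k. \<Sum>j\<in>J. f j k"] insert f by (simp add: sum_nonneg)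
qed

text \<open>The inclusion \<open>\<ell>\<^sup>s \<subseteq> \<ell>\<^sup>t\<close>: the function is bounded because its \<open>s\<close>-th powers are summable, and a bounded
  factor \<open>f powr (t - s)\<close> preserves summability.\<close>
lemma summable_on_powr_mono:
  fixes f :: "'i \<Rightarrow> real"
  assumes f: "\<And>k. 0 \<le> f k" and sum: "(\<lambda>k. f k powr s) summable_on A" and st: "0 < s" "s \<le> t"
  shows "(\<lambda>k. f k powr t) summable_on A"
proof -
  define B where "B = (\<Sum>\<^sub>\<infinity>k\<in>A. f k powr s) powr (1 / s)"
  have "f k \<le> B" if "k \<in> A" for k
  proof -
    have "f k powr s \<le> (\<Sum>\<^sub>\<infinity>k\<in>A. f k powr s)"
      using finite_sum_le_infsum[OF sum, of "{k}"] that by simp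
    then have "(f k powr s) powr (1 / s) \<le> B"
      unfolding B_def using st by (intro powr_mono2) auto
    then show ?thesis using f st by (simp add: powr_powr)
  qed
  then have "f k powr t \<le> B powr (t - s) * f k powr s" if "k \<in> A" for k
    using that f st powr_mono2[of "t - s" "f k" B] mult_right_mono[of "f k powr (t - s)" "B powr (t - s)" "f k powr s"] by (simp flip: powr_add)
  then show ?thesis
    by (intro summable_on_comparison_test[OF summable_on_cmult_right[OF sum, of "B powr (t - s)"]]) auto
qed

lemma infsum_powr_le:
  fixes f :: "'i \<Rightarrow> real"
  assumes f: "\<And>k. 0 \<le> f k" and sum: "(\<lambda>k. f k powr p) summable_on A" and p: "0 < p" "p \<le> 1"
  shows "(\<Sum>\<^sub>\<infinity>k\<in>A. f k) powr p \<le> (\<Sum>\<^sub>\<infinity>k\<in>A. f k powr p)"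
proof -
  have sf: "f summable_on A" using summable_on_powr_mono[OF f sum p] f by simp
  have "(\<Sum>\<^sub>\<infinity>k\<in>A. f k) \<le> (\<Sum>\<^sub>\<infinity>k\<in>A. f k powr p) powr (1 / p)"
  proof (rule infsum_le_finite_sums[OF sf])
    fix F assume F: "finite F" "F \<subseteq> A"
    have "(\<Sum>k\<in>F. f k) powr p \<le> (\<Sum>k\<in>F. f k powr p)"
      using sum_powr_subadditive[of "{()}" F "\<lambda>k _. f k" p] F f p by simp
    also have "\<dots> \<le> (\<Sum>\<^sub>\<infinity>k\<in>A. f k powr p)"
      using F by (intro finite_sum_le_infsum[OF sum]) auto
    finally have "((\<Sum>k\<in>F. f k) powr p) powr (1 / p) \<le> (\<Sum>\<^sub>\<infinity>k\<in>A. f k powr p) powr (1 / p)"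
      using p by (intro powr_mono2) auto
    then show "(\<Sum>k\<in>F. f k) \<le> (\<Sum>\<^sub>\<infinity>k\<in>A. f k powr p) powr (1 / p)"
      using p f by (simp add: powr_powr sum_nonneg)
  qed
  then have "(\<Sum>\<^sub>\<infinity>k\<in>A. f k) powr p \<le> ((\<Sum>\<^sub>\<infinity>k\<in>A. f k powr p) powr (1 / p)) powr p"
    using p f by (intro powr_mono2 infsum_nonneg) auto
  then show ?thesis using p by (simp add: powr_powr infsum_nonneg)
qed

text \<open>Since \<open>(\<Sum> f)\<^sup>p \<le> \<Sum> f\<^sup>p \<le> S \<le> 1\<close>, the sum is at most \<open>1\<close>, where raising to a power \<open>p \<le> 1\<close> only
  increases it.\<close>
lemma infsum_le_of_infsum_powr_le:
  fixes f :: "'i \<Rightarrow> real"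
  assumes f: "\<And>k. 0 \<le> f k" and sum: "(\<lambda>k. f k powr p) summable_on A" and p: "0 < p" "p \<le> 1"
    and S: "(\<Sum>\<^sub>\<infinity>k\<in>A. f k powr p) \<le> S" "S \<le> 1"
  shows "infsum f A \<le> S"
proof -
  have le: "infsum f A powr p \<le> S" using infsum_powr_le[OF f sum p] S by simp
  have 0: "0 \<le> infsum f A" using f by (simp add: infsum_nonneg)
  have "infsum f A \<le> 1"
  proof (rule ccontr)
    assume "\<not> infsum f A \<le> 1"
    then have "1 powr p < infsum f A powr p" using p by (intro powr_less_mono2) auto
    with le S show False by simp
  qed
  then have "infsum f A \<le> infsum f A powr p"
    using powr_mono'[of p 1 "infsum f A"] 0 p by simp
  with le show ?thesis by simp
qed

lemma has_sum_finite_sum: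
  fixes g :: "'j \<Rightarrow> 'i \<Rightarrow> real"
  assumes "finite E" "\<And>e. e \<in> E \<Longrightarrow> (g e has_sum S e) A"
  shows "((\<lambda>t. \<Sum>e\<in>E. g e t) has_sum (\<Sum>e\<in>E. S e)) A"
  using assms by (induction E) (auto intro!: has_sum_add)

section \<open>The subadditive power of the quasi-norm\<close>

text \<open>The largest exponent \<open>r \<le> 1\<close> for which the \<open>r\<close>-th power of the \<open>\<ell>\<^sup>p\<close> (quasi-)norm is subadditive.\<close>
definition subexp :: "ereal \<Rightarrow> real" where
  "subexp p = real_of_ereal (min 1 p)"

definition lp_mass :: "ereal \<Rightarrow> ('i \<Rightarrow> 'b::real_normed_vector) \<Rightarrow> real" where
  "lp_mass p f = lp_norm p f powr subexp p"

lemma subexp_simps [simp]: "subexp \<infinity> = 1" "subexp (ereal x) = min 1 x"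
  by (simp_all add: subexp_def min_def one_ereal_def)

lemma pos_ereal_cases:
  assumes "0 < p"
  obtains (real) x where "p = ereal x" "0 < x" | (infty) "p = \<infinity>"
  using assms by (cases p) auto

lemma subexp_bounds: 
  assumes "0 < p"
  shows "0 < subexp p" "subexp p \<le> 1"
  using assms by (cases rule: pos_ereal_cases; simp)+

lemma subexp_ge:
  assumes "0 < p0" "p0 \<le> 1" "ereal p0 \<le> p"
  shows "p0 \<le> subexp p"
  using assms by (cases p) auto

lemma mem_lp_space_real: "f \<in> lp_space (ereal x) \<longleftrightarrow> (\<lambda>k. norm (f k) powr x) summable_on UNIV"
  by (simp add: lp_space_def)

lemma mem_lp_space_infty: "f \<in> lp_space \<infinity> \<longleftrightarrow> (\<exists>B. \<forall>k. norm (f k) \<le> B)"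
  by (auto simp: lp_space_def bounded_iff)

lemma lp_mass_real: 
  "0 < x \<Longrightarrow> lp_mass (ereal x) f = (\<Sum>\<^sub>\<infinity>k. norm (f k) powr x) powr (min 1 x / x)"
  by (simp add: lp_mass_def lp_norm_def powr_powr)

lemma bdd_above_norm_range: "f \<in> lp_space \<infinity> \<Longrightarrow> bdd_above (range (\<lambda>k. norm (f k)))"
  unfolding mem_lp_space_infty by (auto intro: bdd_aboveI2)

lemma lp_mass_infty: 
  assumes "f \<in> lp_space \<infinity>"
  shows "lp_mass \<infinity> f = (SUP k. norm (f k))"
proof -
  have "0 \<le> (SUP k. norm (f k))"
    by (rule order_trans[OF norm_ge_zero cSUP_upper[OF UNIV_I bdd_above_norm_range[OF assms]]])
  then show ?thesis by (simp add: lp_mass_def lp_norm_def)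
qed

lemma lp_mass_nonneg [simp]: "0 \<le> lp_mass p f"
  by (simp add: lp_mass_def)

lemma lp_norm_nonneg: 
  assumes "0 < p" "f \<in> lp_space p"
  shows "0 \<le> lp_norm p f"
  using assms(1)
proof (cases rule: pos_ereal_cases)
  case (real x)
  then show ?thesis by (simp add: lp_norm_def)
next
  case infty
  with assms(2) have "bdd_above (range (\<lambda>k. norm (f k)))" by (simp add: bdd_above_norm_range)
  from order_trans[OF norm_ge_zero cSUP_upper[OF UNIV_I this]] show ?thesis
    by (simp add: infty lp_norm_def)
qed

lemma lp_mass_norm [simp]: "lp_mass p (\<lambda>k. norm (f k)) = lp_mass p f"
  by (simp add: lp_mass_def lp_norm_def)

lemma lp_space_norm [simp]: "(\<lambda>k. norm (f k)) \<in> lp_space p \<longleftrightarrow> f \<in> lp_space p"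
  by (cases p) (simp_all add: lp_space_def bounded_iff)

lemma norm_powr_le_lp_mass:
  assumes p: "0 < p" and f: "f \<in> lp_space p"
  shows "norm (f k) powr subexp p \<le> lp_mass p f"
  using p
proof (cases rule: pos_ereal_cases)
  case (real x)
  have "norm (f k) powr x \<le> (\<Sum>\<^sub>\<infinity>k. norm (f k) powr x)"
    using finite_sum_le_infsum[of "\<lambda>k. norm (f k) powr x" UNIV "{k}"] f 
    by (simp add: real mem_lp_space_real)
  then have "(norm (f k) powr x) powr (min 1 x / x) \<le> lp_mass p f"
    using real by (simp add: lp_mass_real powr_mono2)
  then show ?thesis using real by (simp add: powr_powr)
next
  case infty
  then show ?thesis 
    using cSUP_upper[OF UNIV_I bdd_above_norm_range[of f], of k] f by (simp add: lp_mass_infty)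
qed

text \<open>Every sequence in play is therefore bounded, which makes all convolutions with summable kernels
  converge.\<close>
lemma lp_space_subset_infty:
  assumes "0 < p" "f \<in> lp_space p"
  shows "f \<in> lp_space \<infinity>"
proof -
  have "norm (f k) \<le> lp_mass p f powr (1 / subexp p)" for k
  proof -
    have "(norm (f k) powr subexp p) powr (1 / subexp p) \<le> lp_mass p f powr (1 / subexp p)"
      using norm_powr_le_lp_mass[OF assms, of k] subexp_bounds[OF assms(1)] 
      by (intro powr_mono2) auto
    then show ?thesis using subexp_bounds[OF assms(1)] by (simp add: powr_powr)
  qed
  then show ?thesis by (auto simp: mem_lp_space_infty)
qed

text \<open>For finite \<open>p\<close> the finite inequality \<open>sum_powr_subadditive\<close> is passed to the limit, over the finite
  subsets of \<open>J\<close> with the finite set of indices \<open>K\<close> held fixed, and then over \<open>K\<close>. The conclusion that \<open>F\<close> lies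
  in the space is part of the statement because \<open>lp_norm\<close> is meaningless outside of it.\<close>
lemma lp_mass_subadditive:
  fixes F :: "'i \<Rightarrow> 'b::real_normed_vector" and f :: "'j \<Rightarrow> 'i \<Rightarrow> real"
  assumes p: "0 < p" and f: "\<And>j. j \<in> J \<Longrightarrow> f j \<in> lp_space p" and nonneg: "\<And>j k. 0 \<le> f j k"
    and sum: "(\<lambda>j. lp_mass p (f j)) summable_on J"
    and le: "\<And>k. norm (F k) \<le> (\<Sum>\<^sub>\<infinity>j\<in>J. f j k)"
  shows "F \<in> lp_space p" and "lp_mass p F \<le> (\<Sum>\<^sub>\<infinity>j\<in>J. lp_mass p (f j))"
proof -
  define S where "S = (\<Sum>\<^sub>\<infinity>j\<in>J. lp_mass p (f j))"
  have S0: "0 \<le> S" unfolding S_def by (intro infsum_nonneg) auto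
  have pt: "f j k powr subexp p \<le> lp_mass p (f j)" if "j \<in> J" for j k
    using norm_powr_le_lp_mass[OF p f, of j k] that nonneg by simp
  have "(\<lambda>j. f j k powr subexp p) summable_on J" for k
    by (rule summable_on_comparison_test[OF sum]) (use pt in auto)
  then have sumf: "(\<lambda>j. f j k) summable_on J" for k
    using summable_on_powr_mono[of "\<lambda>j. f j k" "subexp p" J 1] nonneg subexp_bounds[OF p] by simp
  from p have "F \<in> lp_space p \<and> lp_mass p F \<le> S"
  proof (cases rule: pos_ereal_cases)
    case (real x)
    let ?r = "min 1 x"
    \<comment> \<open>The exponent \<open>x / ?r\<close> undoes the outer power \<open>?r / x\<close> in the mass.\<close>
    have finite: "(\<Sum>k\<in>K. norm (F k) powr x) \<le> S powr (x / ?r)" if K: "finite K" for K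
    proof -
      have part: "(\<Sum>k\<in>K. (\<Sum>j\<in>J'. f j k) powr x) \<le> S powr (x / ?r)" 
        if J': "finite J'" "J' \<subseteq> J" for J'
      proof -
        have "(\<Sum>k\<in>K. f j k powr x) powr (?r / x) \<le> lp_mass p (f j)" if "j \<in> J" for j
        proof -
          have "(\<Sum>k\<in>K. f j k powr x) \<le> (\<Sum>\<^sub>\<infinity>k. norm (f j k) powr x)"
            using finite_sum_le_infsum[of "\<lambda>k. norm (f j k) powr x" UNIV K] f[OF that] K nonneg
            by (simp add: mem_lp_space_real real)
          then show ?thesis using real nonneg by (simp add: lp_mass_real powr_mono2 sum_nonneg)
        qed
        then have "(\<Sum>j\<in>J'. (\<Sum>k\<in>K. f j k powr x) powr (?r / x)) \<le> (\<Sum>j\<in>J'. lp_mass p (f j))"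
          using J' by (intro sum_mono) auto
        also have "\<dots> \<le> S"
          unfolding S_def using J' by (intro finite_sum_le_infsum[OF sum]) auto
        finally have "(\<Sum>k\<in>K. (\<Sum>j\<in>J'. f j k) powr x) powr (?r / x) \<le> S"
          using sum_powr_subadditive[of K J' f x, OF K J'(1) nonneg real(2)] by linarith
        then have "((\<Sum>k\<in>K. (\<Sum>j\<in>J'. f j k) powr x) powr (?r / x)) powr (x / ?r) \<le> S powr (x / ?r)"
          using real by (intro powr_mono2) auto
        moreover have "min 1 x \<noteq> 0" using real by simp
        ultimately show ?thesis using real by (simp add: powr_powr sum_nonneg)
      qed
      have "((\<lambda>J'. \<Sum>k\<in>K. (\<Sum>j\<in>J'. f j k) powr x) \<longlongrightarrow> (\<Sum>k\<in>K. (\<Sum>\<^sub>\<infinity>j\<in>J. f j k) powr x)) 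
               (finite_subsets_at_top J)"
        using real nonneg
        by (intro tendsto_sum tendsto_powr' infsum_tendsto sumf tendsto_const) (auto simp: sum_nonneg)
      then have "(\<Sum>k\<in>K. (\<Sum>\<^sub>\<infinity>j\<in>J. f j k) powr x) \<le> S powr (x / ?r)"
        by (rule tendsto_upperbound) 
           (auto simp: eventually_finite_subsets_at_top intro!: exI[of _ "{}"] part)
      moreover have "(\<Sum>k\<in>K. norm (F k) powr x) \<le> (\<Sum>k\<in>K. (\<Sum>\<^sub>\<infinity>j\<in>J. f j k) powr x)"
        using real le by (intro sum_mono powr_mono2) auto
      ultimately show ?thesis by linarith
    qed
    have mem: "(\<lambda>k. norm (F k) powr x) summable_on UNIV"
      using finite by (intro nonneg_bdd_above_summable_on bdd_aboveI2[of _ _ "S powr (x / ?r)"]) auto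
    have "(\<Sum>\<^sub>\<infinity>k. norm (F k) powr x) \<le> S powr (x / ?r)"
      using finite by (intro infsum_le_finite_sums[OF mem]) auto
    then have "lp_mass p F \<le> (S powr (x / ?r)) powr (?r / x)"
      using real by (simp only: lp_mass_real) (intro powr_mono2, auto intro: infsum_nonneg)
    also have "\<dots> = S" using real S0 by (simp add: powr_powr)
    finally show ?thesis using mem real by (simp add: mem_lp_space_real)
  next
    case infty
    have *: "norm (F k) \<le> S" for k
    proof -
      have "(\<Sum>\<^sub>\<infinity>j\<in>J. f j k) \<le> S"
        unfolding S_def using pt infty nonneg by (intro infsum_mono sumf sum) auto
      then show ?thesis using le[of k] by linarith
    qed
    then have "F \<in> lp_space \<infinity>" by (auto simp: mem_lp_space_infty)
    with * show ?thesis by (auto simp: infty lp_mass_infty intro!: cSUP_least)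
  qed
  then show "F \<in> lp_space p" and "lp_mass p F \<le> (\<Sum>\<^sub>\<infinity>j\<in>J. lp_mass p (f j))"
    by (auto simp: S_def)
qed

lemma lp_mass_sum_le:
  fixes F :: "'i \<Rightarrow> 'b::real_normed_vector" and f :: "'j \<Rightarrow> 'i \<Rightarrow> 'c::real_normed_vector"
  assumes p: "0 < p" and J: "finite J" and f: "\<And>j. j \<in> J \<Longrightarrow> f j \<in> lp_space p"
    and le: "\<And>k. norm (F k) \<le> (\<Sum>j\<in>J. norm (f j k))"
  shows "F \<in> lp_space p" and "lp_mass p F \<le> (\<Sum>j\<in>J. lp_mass p (f j))"
  using lp_mass_subadditive[of p J "\<lambda>j k. norm (f j k)" F] assms by simp_all

lemma lp_mass_add_le:
  fixes F :: "'i \<Rightarrow> 'b::real_normed_vector" and f :: "'i \<Rightarrow> 'c::real_normed_vector" 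
    and g :: "'i \<Rightarrow> 'e::real_normed_vector"
  assumes p: "0 < p" and f: "f \<in> lp_space p" and g: "g \<in> lp_space p"
    and le: "\<And>k. norm (F k) \<le> norm (f k) + norm (g k)"
  shows "F \<in> lp_space p" and "lp_mass p F \<le> lp_mass p f + lp_mass p g"
proof -
  define \<phi> where "\<phi> = (\<lambda>b k. if b then norm (f k) else norm (g k))"
  have "\<phi> b \<in> lp_space p" for b using f g by (cases b) (simp_all add: \<phi>_def)
  moreover have "norm (F k) \<le> (\<Sum>b\<in>UNIV. norm (\<phi> b k))" for k
    using le[of k] by (simp add: UNIV_bool \<phi>_def)
  ultimately have "F \<in> lp_space p \<and> lp_mass p F \<le> (\<Sum>b\<in>UNIV. lp_mass p (\<phi> b))"
    using lp_mass_sum_le[of p UNIV \<phi> F] p by simp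
  then show "F \<in> lp_space p" and "lp_mass p F \<le> lp_mass p f + lp_mass p g"
    by (simp_all add: UNIV_bool \<phi>_def)
qed

lemma lp_mass_dominated:
  fixes F :: "'i \<Rightarrow> 'b::real_normed_vector" and f :: "'i \<Rightarrow> 'c::real_normed_vector"
  assumes p: "0 < p" and f: "f \<in> lp_space p" and c: "0 \<le> c"
    and le: "\<And>k. norm (F k) \<le> c * norm (f k)"
  shows "F \<in> lp_space p" and "lp_mass p F \<le> c powr subexp p * lp_mass p f"
proof -
  from p have "F \<in> lp_space p \<and> lp_mass p F \<le> c powr subexp p * lp_mass p f"
  proof (cases rule: pos_ereal_cases)
    case (real x)
    have fx: "(\<lambda>k. norm (f k) powr x) summable_on UNIV"
      using f by (simp add: real mem_lp_space_real)
    have le': "norm (F k) powr x \<le> c powr x * norm (f k) powr x" for k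
      using powr_mono2[OF _ _ le[of k], of x] real c by (simp add: powr_mult)
    have mem: "(\<lambda>k. norm (F k) powr x) summable_on UNIV"
      by (rule summable_on_comparison_test[OF summable_on_cmult_right[OF fx]]) (use le' in auto)
    have "(\<Sum>\<^sub>\<infinity>k. norm (F k) powr x) \<le> (\<Sum>\<^sub>\<infinity>k. c powr x * norm (f k) powr x)"
      by (intro infsum_mono mem summable_on_cmult_right fx le')
    also have "\<dots> = c powr x * (\<Sum>\<^sub>\<infinity>k. norm (f k) powr x)"
      by (rule infsum_cmult_right')
    finally have "lp_mass p F \<le> (c powr x * (\<Sum>\<^sub>\<infinity>k. norm (f k) powr x)) powr (min 1 x / x)"
      using real by (simp only: lp_mass_real) (intro powr_mono2, auto intro: infsum_nonneg)
    also have "\<dots> = c powr subexp p * lp_mass p f"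
      using real by (simp add: lp_mass_real powr_mult powr_powr infsum_nonneg)
    finally show ?thesis using mem by (simp add: real mem_lp_space_real)
  next
    case infty
    have *: "norm (F k) \<le> c * lp_mass \<infinity> f" for k
    proof -
      have "norm (f k) \<le> lp_mass \<infinity> f"
        using norm_powr_le_lp_mass[OF p f, of k] by (simp add: infty)
      then show ?thesis using le[of k] mult_left_mono[OF _ c] by (meson order_trans)
    qed
    then have "F \<in> lp_space \<infinity>" by (auto simp: mem_lp_space_infty)
    with * c show ?thesis by (auto simp: infty lp_mass_infty intro!: cSUP_least)
  qed
  then show "F \<in> lp_space p" and "lp_mass p F \<le> c powr subexp p * lp_mass p f" by auto
qed

lemma lp_mass_shift:
  fixes f :: "'i::ab_group_add \<Rightarrow> 'b::real_normed_vector"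
  shows "(\<lambda>k. f (k - s)) \<in> lp_space p \<longleftrightarrow> f \<in> lp_space p"
    and "lp_mass p (\<lambda>k. f (k - s)) = lp_mass p f"
proof -
  have bij: "bij_betw (\<lambda>k. k - s) UNIV UNIV"
    by (rule bij_betwI[where g = "\<lambda>k. k + s"]) auto
  then have surj: "range (\<lambda>k. k - s) = UNIV" by (simp add: bij_betw_def)
  have rng: "range (\<lambda>k. h (k - s)) = range h" for h :: "'i \<Rightarrow> 'x"
    by (metis (no_types) image_image surj)
  show "(\<lambda>k. f (k - s)) \<in> lp_space p \<longleftrightarrow> f \<in> lp_space p"
    using summable_on_reindex_bij_betw[OF bij, of "\<lambda>k. norm (f k) powr real_of_ereal p"] rng[of f]
    by (simp add: lp_space_def)
  have "lp_norm p (\<lambda>k. f (k - s)) = lp_norm p f"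
    using infsum_reindex_bij_betw[OF bij, of "\<lambda>k. norm (f k) powr real_of_ereal p"] 
      rng[of "\<lambda>k. norm (f k)"]
    by (simp add: lp_norm_def)
  then show "lp_mass p (\<lambda>k. f (k - s)) = lp_mass p f" by (simp add: lp_mass_def)
qed

text \<open>Such a function is a finite sum of multiples of unit vectors.\<close>
lemma lp_mass_finite_support:
  fixes F :: "'i \<Rightarrow> 'b::real_normed_vector"
  assumes p: "0 < p" and E: "finite E" and supp: "\<And>k. k \<notin> E \<Longrightarrow> F k = 0"
  shows "F \<in> lp_space p" and "lp_mass p F \<le> (\<Sum>k\<in>E. norm (F k) powr subexp p)"
proof -
  define f where "f = (\<lambda>j k. if k = j then norm (F j) else 0)"
  have f: "f j \<in> lp_space p \<and> lp_mass p (f j) \<le> norm (F j) powr subexp p" for j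
    using p
  proof (cases rule: pos_ereal_cases)
    case (real x)
    have eq: "(\<lambda>k. norm (f j k) powr x) = (\<lambda>k. if k = j then norm (F j) powr x else 0)"
      by (auto simp: f_def)
    have "((\<lambda>k. norm (f j k) powr x) has_sum norm (F j) powr x) UNIV"
      unfolding eq by (rule has_sum_finite_neutralI[of "{j}"]) auto
    then show ?thesis
      using real by (auto simp: mem_lp_space_real lp_mass_real powr_powr has_sum_iff)
  next
    case infty
    have "f j \<in> lp_space \<infinity>" 
      unfolding mem_lp_space_infty by (intro exI[of _ "norm (F j)"]) (auto simp: f_def)
    moreover from this have "lp_mass \<infinity> (f j) \<le> norm (F j)"
      unfolding lp_mass_infty[OF \<open>f j \<in> lp_space \<infinity>\<close>] by (intro cSUP_least) (auto simp: f_def)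
    ultimately show ?thesis by (simp add: infty)
  qed
  have le: "norm (F k) \<le> (\<Sum>\<^sub>\<infinity>j\<in>E. f j k)" for k
    using E supp[of k] by (cases "k \<in> E") (auto simp: f_def sum.delta')
  have nonneg: "0 \<le> f j k" for j k by (simp add: f_def)
  have sum: "(\<lambda>j. lp_mass p (f j)) summable_on E" using E by simp
  note * = lp_mass_subadditive[of p E f F, OF p _ nonneg sum le]
  show "F \<in> lp_space p" using * f by blast
  have "lp_mass p F \<le> (\<Sum>j\<in>E. lp_mass p (f j))" using *(2) f E by simp
  also have "\<dots> \<le> (\<Sum>j\<in>E. norm (F j) powr subexp p)" using f by (intro sum_mono) auto
  finally show "lp_mass p F \<le> (\<Sum>k\<in>E. norm (F k) powr subexp p)" .
qed

text \<open>Passing from \<open>f\<close> to \<open>\<bar>f\<bar>\<^sup>r\<close> rescales the exponent; with it an inequality between \<open>r\<close>-th powers can be read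
  in \<open>\<ell>\<^sup>q\<close>. The exponent \<open>q / ereal r\<close> stays \<open>\<infinity>\<close> for \<open>q = \<infinity>\<close>.\<close>
lemma lp_power:
  assumes r: "0 < r" and q: "0 < q" and f: "f \<in> lp_space q"
  shows "(\<lambda>k. norm (f k) powr r) \<in> lp_space (q / ereal r)"
    and "lp_norm (q / ereal r) (\<lambda>k. norm (f k) powr r) = lp_norm q f powr r"
proof -
  have "(\<lambda>k. norm (f k) powr r) \<in> lp_space (q / ereal r) \<and>
        lp_norm (q / ereal r) (\<lambda>k. norm (f k) powr r) = lp_norm q f powr r"
    using q
  proof (cases rule: pos_ereal_cases)
    case (real x)
    then show ?thesis using r f by (simp add: mem_lp_space_real lp_norm_def powr_powr)
  next
    case infty
    have f': "f \<in> lp_space \<infinity>" using f infty by simp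
    then obtain B where B: "norm (f k) \<le> B" for k by (auto simp: mem_lp_space_infty)
    have mem: "(\<lambda>k. norm (f k) powr r) \<in> lp_space \<infinity>"
      unfolding mem_lp_space_infty using B r by (intro exI[of _ "B powr r"]) (auto intro: powr_mono2)
    have up: "norm (f k) \<le> (SUP k. norm (f k))" for k
      using cSUP_upper[OF UNIV_I bdd_above_norm_range[OF f'], of k] by simp
    have up': "norm (f k) powr r \<le> (SUP k. norm (f k) powr r)" for k
      using cSUP_upper[OF UNIV_I bdd_above_norm_range[OF mem], of k] by simp
    have "(SUP k. norm (f k) powr r) \<le> (SUP k. norm (f k)) powr r"
      using up r by (intro cSUP_least powr_mono2) auto
    moreover have "(SUP k. norm (f k)) powr r \<le> (SUP k. norm (f k) powr r)"
    proof -
      have "norm (f k) \<le> (SUP k. norm (f k) powr r) powr (1 / r)" for k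
        using powr_mono2[OF _ _ up'[of k], of "1 / r"] r by (simp add: powr_powr)
      then have "(SUP k. norm (f k)) \<le> (SUP k. norm (f k) powr r) powr (1 / r)"
        by (intro cSUP_least) auto
      then have "(SUP k. norm (f k)) powr r \<le> ((SUP k. norm (f k) powr r) powr (1 / r)) powr r"
        using r order_trans[OF norm_ge_zero up] by (intro powr_mono2) auto
      then show ?thesis using r order_trans[OF powr_ge_zero up'] by (simp add: powr_powr)
    qed
    ultimately show ?thesis using mem r infty by (simp add: lp_norm_def)
  qed
  then show "(\<lambda>k. norm (f k) powr r) \<in> lp_space (q / ereal r)"
    and "lp_norm (q / ereal r) (\<lambda>k. norm (f k) powr r) = lp_norm q f powr r" by auto
qed

section \<open>Convolution\<close>

definition conv :: "('i::ab_group_add \<Rightarrow> real) \<Rightarrow> ('i \<Rightarrow> real) \<Rightarrow> 'i \<Rightarrow> real" where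
  "conv g x k = (\<Sum>\<^sub>\<infinity>s. g s * x (k - s))"

lemma bij_diff: "bij_betw (\<lambda>s. k - s) UNIV (UNIV :: 'i::ab_group_add set)"
  by (rule bij_betwI[where g = "\<lambda>s. k - s"]) auto

lemma bij_minus: "bij_betw (\<lambda>k. k - s) UNIV (UNIV :: 'i::ab_group_add set)"
  by (rule bij_betwI[where g = "\<lambda>k. k + s"]) auto

lemma conv_flip: "conv g x k = (\<Sum>\<^sub>\<infinity>l. g (k - l) * x l)"
  unfolding conv_def
  using infsum_reindex_bij_betw[OF bij_diff[of k], of "\<lambda>l. g (k - l) * x l"] by simp

lemma conv_nonneg: "(\<And>k. 0 \<le> g k) \<Longrightarrow> (\<And>k. 0 \<le> x k) \<Longrightarrow> 0 \<le> conv g x k"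
  unfolding conv_def by (intro infsum_nonneg) auto

lemma summable_on_conv:
  fixes g x :: "'i::ab_group_add \<Rightarrow> real"
  assumes "g summable_on UNIV" "\<And>k. 0 \<le> g k" "\<And>k. \<bar>x k\<bar> \<le> B"
  shows "(\<lambda>s. g s * x (k - s)) summable_on UNIV"
proof -
  have "(\<lambda>s. norm (g s * x (k - s))) summable_on UNIV"
    by (rule Infinite_Sum.abs_summable_on_comparison_test'[OF summable_on_cmult_left[OF assms(1), of B]])
       (use assms(2,3) in \<open>auto simp: abs_mult intro!: mult_left_mono\<close>)
  then show ?thesis by (rule abs_summable_summable)
qed

lemma conv_mono:
  assumes g: "g summable_on UNIV" "\<And>k. 0 \<le> g k" 
    and "\<And>k. \<bar>x k\<bar> \<le> B" "\<And>k. \<bar>y k\<bar> \<le> C" "\<And>k. x k \<le> y k"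
  shows "conv g x k \<le> conv g y k"
  unfolding conv_def using assms
  by (intro infsum_mono summable_on_conv) (auto intro!: mult_left_mono)

lemma conv_mono_left:
  assumes "g summable_on UNIV" "\<And>k. 0 \<le> g k" "h summable_on UNIV" "\<And>k. g k \<le> h k"
    and "\<And>k. 0 \<le> x k" "\<And>k. x k \<le> B" 
  shows "conv g x k \<le> conv h x k"
proof -
  have "0 \<le> h k" for k using assms(2,4) order_trans by blast
  then show ?thesis 
    unfolding conv_def using assms
    by (intro infsum_mono summable_on_conv[of _ _ B]) (auto intro!: mult_right_mono)
qed

lemma conv_add_const:
  assumes g: "g summable_on UNIV" "\<And>k. 0 \<le> g k" and x: "\<And>k. \<bar>x k\<bar> \<le> B"
  shows "conv g (\<lambda>k. x k + c) k = conv g x k + infsum g UNIV * c"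
  unfolding conv_def distrib_left
  by (subst infsum_add) (auto simp: infsum_cmult_left' intro: summable_on_conv[OF g x] summable_on_cmult_left g)

lemma conv_add_left:
  assumes g: "g summable_on UNIV" "\<And>k. 0 \<le> g k" and h: "h summable_on UNIV" "\<And>k. 0 \<le> h k" 
    and x: "\<And>k. \<bar>x k\<bar> \<le> B"
  shows "conv (\<lambda>k. g k + h k) x k = conv g x k + conv h x k"
  unfolding conv_def distrib_right
  by (intro infsum_add summable_on_conv[OF g x] summable_on_conv[OF h x])

lemma conv_sum_left:
  assumes "finite E" and "\<And>e. e \<in> E \<Longrightarrow> g e summable_on UNIV" and "\<And>e k. 0 \<le> g e k" 
    and x: "\<And>k. \<bar>x k\<bar> \<le> B"
  shows "conv (\<lambda>t. \<Sum>e\<in>E. g e t) x k = (\<Sum>e\<in>E. conv (g e) x k)"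
  unfolding conv_def sum_distrib_right using assms
  by (intro infsumI has_sum_finite_sum has_sum_infsum summable_on_conv) auto

lemma conv_cmult_left: "conv (\<lambda>t. K * g t) x k = K * conv g x k"
  by (simp add: conv_def mult.assoc infsum_cmult_right')

lemma conv_shift: "conv (\<lambda>t. g (t + v)) x k = conv g x (k + v)"
  unfolding conv_flip by (simp add: algebra_simps)

lemma abs_conv_le:
  assumes g: "g summable_on UNIV" "\<And>k. 0 \<le> g k" and x: "\<And>k. \<bar>x k\<bar> \<le> B"
  shows "\<bar>conv g x k\<bar> \<le> infsum g UNIV * B"
proof -
  have "conv g x k \<le> conv g (\<lambda>_. B) k"
    by (rule conv_mono[OF g x, of "\<lambda>_. B" "\<bar>B\<bar>"]) (use x in \<open>auto simp: abs_le_iff\<close>)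
  moreover have "conv g (\<lambda>_. - B) k \<le> conv g x k"
    by (rule conv_mono[OF g _ x, of "\<lambda>_. -B" "\<bar>B\<bar>"]) (use x in \<open>auto simp: abs_le_iff minus_le_iff\<close>)
  ultimately show ?thesis
    by (simp add: conv_def infsum_cmult_left' abs_le_iff infsum_uminus)
qed

lemma conv_delta [simp]: "conv (\<lambda>k. if k = 0 then 1 else 0) x = x"
proof
  fix k
  have "((\<lambda>s. (if s = 0 then 1 else 0) * x (k - s)) has_sum x k) UNIV"
    by (rule has_sum_finite_neutralI[of "{0}"]) auto
  then show "conv (\<lambda>k. if k = 0 then 1 else 0) x k = x k"
    unfolding conv_def by (rule infsumI)
qed

text \<open>Fubini's theorem for two matrices dominated by convolution kernels: the double series converges
  absolutely because \<open>g (k - m) * w (m - l)\<close> is summable over all pairs \<open>(m, l)\<close>. It gives the associativity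
  of convolution and, for complex entries, that of the matrix product.\<close>
lemma dominated_matrix_assoc:
  fixes A B :: "'i::ab_group_add \<Rightarrow> 'i \<Rightarrow> 'a::{real_normed_field,banach}"
  assumes A: "\<And>k l. norm (A k l) \<le> g (k - l)" and B: "\<And>k l. norm (B k l) \<le> w (k - l)"
    and g: "g summable_on UNIV" and w: "w summable_on UNIV" and y: "\<And>l. norm (y l) \<le> M"
  shows "(\<Sum>\<^sub>\<infinity>m. A k m * (\<Sum>\<^sub>\<infinity>l. B m l * y l)) = (\<Sum>\<^sub>\<infinity>l. (\<Sum>\<^sub>\<infinity>m. A k m * B m l) * y l)"
proof -
  have g0: "0 \<le> g s" and w0: "0 \<le> w s" for s
    using norm_ge_zero[THEN order_trans, OF A[of s 0]] norm_ge_zero[THEN order_trans, OF B[of s 0]]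
    by simp_all
  have M: "0 \<le> M" using y[of 0] norm_ge_zero order_trans by blast
  have "((\<lambda>l. g (k - m) * w (m - l)) has_sum g (k - m) * infsum w UNIV) UNIV" for m
    using infsum_reindex_bij_betw[OF bij_diff[of m], of w] 
      summable_on_reindex_bij_betw[OF bij_diff[of m], of w] w
    by (intro has_sum_cmult_right) (simp add: has_sum_iff)
  moreover have "(\<lambda>m. g (k - m) * infsum w UNIV) summable_on UNIV"
    using summable_on_reindex_bij_betw[OF bij_diff[of k], of g] g
    by (intro summable_on_cmult_left) simp
  ultimately have "(\<lambda>(m, l). g (k - m) * w (m - l)) summable_on UNIV \<times> UNIV"
    by (intro summable_on_SigmaI[where g = "\<lambda>m. g (k - m) * infsum w UNIV"]) (auto simp: g0 w0)
  from summable_on_cmult_left[OF this, of M]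
  have "(\<lambda>(m, l). g (k - m) * w (m - l) * M) summable_on UNIV \<times> UNIV" 
    by (simp add: case_prod_unfold)
  then have "(\<lambda>p. norm ((\<lambda>(m, l). A k m * B m l * y l) p)) summable_on UNIV \<times> UNIV"
    by (rule Infinite_Sum.abs_summable_on_comparison_test')
       (auto simp: norm_mult intro!: mult_mono mult_nonneg_nonneg A B y g0 w0 M)
  then have "(\<lambda>(m, l). A k m * B m l * y l) summable_on UNIV \<times> UNIV"
    by (rule abs_summable_summable)
  from infsum_swap_banach[OF this] show ?thesis
    by (simp add: infsum_cmult_right' infsum_cmult_left' mult.assoc flip: infsum_cmult_left')
qed

lemma conv_assoc:
  assumes g: "g summable_on UNIV" "\<And>k. 0 \<le> g k" and w: "w summable_on UNIV" "\<And>k. 0 \<le> w k"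
    and y: "\<And>k. \<bar>y k\<bar> \<le> B"
  shows "conv g (conv w y) = conv (conv g w) y"
proof
  fix k
  have "(\<Sum>\<^sub>\<infinity>m. g (k - m) * w (m - l)) = conv g w (k - l)" for l
    using infsum_reindex_bij_betw[OF bij_diff[of k], of "\<lambda>m. g (k - m) * w (m - l)"] 
    by (simp add: conv_def algebra_simps)
  moreover have "(\<Sum>\<^sub>\<infinity>m. g (k - m) * (\<Sum>\<^sub>\<infinity>l. w (m - l) * y l)) 
      = (\<Sum>\<^sub>\<infinity>l. (\<Sum>\<^sub>\<infinity>m. g (k - m) * w (m - l)) * y l)"
    by (rule dominated_matrix_assoc[where g = g and w = w and M = B]) (use assms in auto)
  ultimately show "conv g (conv w y) k = conv (conv g w) y k"
    by (simp add: conv_flip)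
qed

text \<open>Young's inequality for all exponents at once. A convolution is a superposition of translates, all of which
  have the same mass, so it is an instance of countable subadditivity.\<close>
lemma lp_mass_conv:
  fixes F f :: "'i::ab_group_add \<Rightarrow> 'b::real_normed_vector"
  assumes p: "0 < p" and f: "f \<in> lp_space p" and g: "\<And>s. 0 \<le> g s" 
    and sum: "(\<lambda>s. g s powr subexp p) summable_on UNIV"
    and le: "\<And>k. norm (F k) \<le> conv g (\<lambda>l. norm (f l)) k"
  shows "F \<in> lp_space p" and "lp_mass p F \<le> (\<Sum>\<^sub>\<infinity>s. g s powr subexp p) * lp_mass p f"
proof -
  define \<phi> where "\<phi> = (\<lambda>s k. g s * norm (f (k - s)))"
  have \<phi>: "\<phi> s \<in> lp_space p" "lp_mass p (\<phi> s) \<le> g s powr subexp p * lp_mass p f" for s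
    using lp_mass_dominated[of p "\<lambda>k. f (k - s)" "g s" "\<phi> s"] p f g
    by (auto simp: \<phi>_def lp_mass_shift)
  have nonneg: "0 \<le> \<phi> s k" for s k by (simp add: \<phi>_def g)
  have sum': "(\<lambda>s. lp_mass p (\<phi> s)) summable_on UNIV"
    by (rule summable_on_comparison_test[OF summable_on_cmult_left[OF sum, of "lp_mass p f"]]) (use \<phi> in auto)
  have le': "norm (F k) \<le> (\<Sum>\<^sub>\<infinity>s. \<phi> s k)" for k
    using le[of k] by (simp add: conv_def \<phi>_def)
  note * = lp_mass_subadditive[of p UNIV \<phi> F, OF p \<phi>(1) nonneg sum' le']
  show "F \<in> lp_space p" using * by blast
  have "(\<Sum>\<^sub>\<infinity>s. lp_mass p (\<phi> s)) \<le> (\<Sum>\<^sub>\<infinity>s. g s powr subexp p * lp_mass p f)"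
    using \<phi> by (intro infsum_mono sum' summable_on_cmult_left sum)
  with * show "lp_mass p F \<le> (\<Sum>\<^sub>\<infinity>s. g s powr subexp p) * lp_mass p f"
    by (simp add: infsum_cmult_left')
qed

section \<open>Neumann series for convolution\<close>

primrec conv_power :: "('i::ab_group_add \<Rightarrow> real) \<Rightarrow> nat \<Rightarrow> 'i \<Rightarrow> real" where
  "conv_power G 0 = (\<lambda>k. if k = 0 then 1 else 0)"
| "conv_power G (Suc n) = conv G (conv_power G n)"

text \<open>The function \<open>u\<close> is the sum of all convolution powers of \<open>G\<close>; the \<open>n\<close>-th power has mass at most \<open>S\<^sup>n\<close> in
  \<open>\<ell>\<^sup>\<theta>\<close>, where \<open>S < 1\<close> is the mass of \<open>G\<close>. Iterating the hypothesis on \<open>x\<close> gives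
  \<open>x \<le> U\<^sub>m * y + S\<^sup>m B\<close> with the partial sums \<open>U\<^sub>m\<close>. The last term tends to \<open>0\<close> since
  \<open>x\<close> is bounded. Because \<open>u\<close> depends on \<open>G\<close> alone, one kernel serves all \<open>x\<close> and \<open>y\<close>.\<close>
lemma neumann_series_domination:
  fixes G :: "'i::ab_group_add \<Rightarrow> real"
  assumes G: "\<And>s. 0 \<le> G s" and \<theta>: "0 < \<theta>" "\<theta> \<le> 1"
    and sum: "(\<lambda>s. G s powr \<theta>) summable_on UNIV" and small: "(\<Sum>\<^sub>\<infinity>s. G s powr \<theta>) < 1"
  obtains u where "\<And>k. 0 \<le> u k" and "(\<lambda>k. u k powr \<theta>) summable_on UNIV"
    and "\<And>x y B k. (\<And>k. 0 \<le> x k \<and> x k \<le> B) \<Longrightarrow> (\<And>k. 0 \<le> y k \<and> y k \<le> B) \<Longrightarrow>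
           (\<And>k. x k \<le> y k + conv G x k) \<Longrightarrow> x k \<le> conv u y k"
proof -
  define S where "S = (\<Sum>\<^sub>\<infinity>s. G s powr \<theta>)"
  have S: "0 \<le> S" "S < 1" using small by (auto simp: S_def intro: infsum_nonneg)
  define P where "P = conv_power G"
  let ?p = "ereal \<theta>"
  have mass: "lp_mass ?p f = (\<Sum>\<^sub>\<infinity>k. norm (f k) powr \<theta>)" for f :: "'i \<Rightarrow> real"
    using \<theta> by (simp add: lp_mass_real infsum_nonneg)
  have P: "P n \<in> lp_space ?p \<and> lp_mass ?p (P n) \<le> S ^ n \<and> (\<forall>k. 0 \<le> P n k)" for n
  proof (induction n)
    case 0
    then show ?case 
      using lp_mass_finite_support[of ?p "{0}" "P 0"] \<theta> by (simp add: P_def)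
  next
    case (Suc n)
    have "norm (P (Suc n) k) \<le> conv G (\<lambda>l. norm (P n l)) k" for k
      using Suc conv_nonneg[of G "P n" k] G by (simp add: P_def)
    from lp_mass_conv[where p = ?p, OF _ _ G _ this] Suc sum \<theta>
    have "P (Suc n) \<in> lp_space ?p" "lp_mass ?p (P (Suc n)) \<le> S * lp_mass ?p (P n)"
      by (simp_all add: S_def)
    moreover have "S * lp_mass ?p (P n) \<le> S * S ^ n"
      using Suc S by (intro mult_left_mono) auto
    moreover have "\<forall>k. 0 \<le> P (Suc n) k"
      using Suc conv_nonneg[of G "P n"] G by (simp add: P_def)
    ultimately show ?case by simp
  qed
  have Pnn: "0 \<le> P n k" for n k using P by blast
  have Psum: "P n summable_on UNIV" for n
    using P[of n] summable_on_powr_mono[of "P n" \<theta> UNIV 1] \<theta> by (simp add: mem_lp_space_real Pnn)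
  have geo: "(\<lambda>n. S ^ n) summable_on UNIV"
    using S by (intro norm_summable_imp_summable_on) (simp add: summable_geometric)
  have sumP: "(\<lambda>n. lp_mass ?p (P n)) summable_on UNIV"
    by (rule summable_on_comparison_test[OF geo]) (use P in auto)
  define u where "u = (\<lambda>k. \<Sum>\<^sub>\<infinity>n. P n k)"
  have u0: "0 \<le> u k" for k unfolding u_def by (intro infsum_nonneg Pnn)
  have "u \<in> lp_space ?p"
    by (rule lp_mass_subadditive(1)[of ?p UNIV P, OF _ _ Pnn sumP]) (use P \<theta> u0 in \<open>auto simp: u_def\<close>)
  then have usum: "(\<lambda>k. u k powr \<theta>) summable_on UNIV" by (simp add: mem_lp_space_real u0)
  have usum1: "u summable_on UNIV"
    using usum summable_on_powr_mono[of u \<theta> UNIV 1] \<theta> by (simp add: u0)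
  have "P n k powr \<theta> \<le> S ^ n" for n k
    using norm_powr_le_lp_mass[of ?p "P n" k] P[of n] \<theta> by (simp add: Pnn)
  then have "(\<lambda>n. P n k powr \<theta>) summable_on UNIV" for k
    by (intro summable_on_comparison_test[OF geo]) auto
  then have sumPk: "(\<lambda>n. P n k) summable_on UNIV" for k
    using summable_on_powr_mono[of "\<lambda>n. P n k" \<theta> UNIV 1] \<theta> by (simp add: Pnn)
  have Gsum: "G summable_on UNIV"
    using sum summable_on_powr_mono[of G \<theta> UNIV 1] \<theta> by (simp add: G)
  have Gle: "infsum G UNIV \<le> S"
    using infsum_le_of_infsum_powr_le[OF G sum \<theta>] S by (simp add: S_def)
  define U where "U = (\<lambda>m k. \<Sum>n<m. P n k)"
  have U0: "0 \<le> U m k" for m k by (simp add: U_def Pnn sum_nonneg)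
  have Usum: "U m summable_on UNIV" for m
    unfolding U_def by (induction m) (auto intro!: summable_on_add Psum)
  have Ule: "U m k \<le> u k" for m k
    unfolding U_def u_def by (intro finite_sum_le_infsum sumPk) (auto simp: Pnn)
  have Pbd: "\<bar>P n k\<bar> \<le> infsum (P n) UNIV" for n k
    using finite_sum_le_infsum[OF Psum, of "{k}" n] Pnn by simp
  \<comment> \<open>Partial sums of the Neumann series satisfy \<open>U\<^sub>m\<^sub>+\<^sub>1 = \<delta> + G * U\<^sub>m\<close>.\<close>
  have USuc: "U (Suc m) = (\<lambda>k. P 0 k + conv G (U m) k)" for m
  proof
    fix k
    have "conv G (U m) k = (\<Sum>n<m. P (Suc n) k)"
    proof (induction m)
      case 0
      then show ?case by (simp add: U_def conv_def)
    next
      case (Suc m)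
      have eq: "U (Suc m) = (\<lambda>k. U m k + P m k)" by (simp add: U_def)
      have Ubd: "\<bar>U m k\<bar> \<le> infsum (U m) UNIV" for k
        using finite_sum_le_infsum[OF Usum, of "{k}" m] U0 by simp
      have "conv G (U (Suc m)) k = conv G (U m) k + conv G (P m) k"
        unfolding eq conv_def distrib_left
        by (rule infsum_add[OF summable_on_conv[OF Gsum G Ubd] summable_on_conv[OF Gsum G Pbd]])
      with Suc show ?case by (simp add: P_def)
    qed
    then show "U (Suc m) k = P 0 k + conv G (U m) k"
      by (simp only: U_def sum.lessThan_Suc_shift)
  qed
  have bound: "x k \<le> conv u y k" 
    if x: "\<And>k. 0 \<le> x k \<and> x k \<le> B" and y: "\<And>k. 0 \<le> y k \<and> y k \<le> B" 
      and xy: "\<And>k. x k \<le> y k + conv G x k" for x y B k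
  proof -
    have ax: "\<bar>x k\<bar> \<le> B" and ay: "\<bar>y k\<bar> \<le> B" for k using x[of k] y[of k] by auto
    have B: "0 \<le> B" using x[of 0] by linarith
    have it: "x k \<le> conv (U m) y k + S ^ m * B" for m k
    proof (induction m arbitrary: k)
      case 0
      then show ?case using x by (simp add: U_def conv_def)
    next
      case (Suc m)
      have cb: "\<bar>conv (U m) y k\<bar> \<le> infsum (U m) UNIV * B" for k
        by (rule abs_conv_le[OF Usum U0 ay])
      have "conv G x k \<le> conv G (\<lambda>k. conv (U m) y k + S ^ m * B) k"
      proof (rule conv_mono[OF Gsum G ax _ Suc])
        show "\<bar>conv (U m) y k + S ^ m * B\<bar> \<le> infsum (U m) UNIV * B + \<bar>S ^ m * B\<bar>" for k
          using cb[of k] by linarith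
      qed
      also have "\<dots> = conv (conv G (U m)) y k + infsum G UNIV * (S ^ m * B)"
        by (simp add: conv_add_const[OF Gsum G cb] conv_assoc[OF Gsum G Usum U0 ay])
      also have "infsum G UNIV * (S ^ m * B) \<le> S * (S ^ m * B)"
        using S B Gle by (intro mult_right_mono) auto
      finally have *: "conv G x k \<le> conv (conv G (U m)) y k + S ^ Suc m * B" by simp
      have "conv G (U m) summable_on UNIV"
        by (rule summable_on_comparison_test[OF Usum[of "Suc m"]]) 
           (auto simp: USuc Pnn intro: conv_nonneg G U0)
      then have "conv (U (Suc m)) y k = conv (P 0) y k + conv (conv G (U m)) y k"
        unfolding USuc by (intro conv_add_left[OF Psum Pnn _ _ ay] conv_nonneg G U0)
      with * xy[of k] show ?case by (simp add: P_def)
    qed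
    have "conv (U m) y k \<le> conv u y k" for m
      by (rule conv_mono_left[OF Usum U0 usum1 Ule, of _ B]) (use y in auto)
    then have "x k \<le> conv u y k + S ^ m * B" for m
      using it[of k m] by (meson add_right_mono order_trans)
    moreover have "(\<lambda>m. conv u y k + S ^ m * B) \<longlonglongrightarrow> conv u y k + 0 * B"
      using S by (intro tendsto_intros LIMSEQ_realpow_zero) auto
    ultimately show ?thesis
      using LIMSEQ_le_const[of "\<lambda>m. conv u y k + S ^ m * B" "conv u y k" "x k"] by auto
  qed
  show ?thesis
    by (rule that[of u]) (use u0 usum bound in blast)+
qed

section \<open>Matrices dominated by convolution\<close>

lemma summable_on_mat_apply:
  fixes a :: "'i::ab_group_add \<Rightarrow> 'i \<Rightarrow> complex"
  assumes a: "\<And>k l. norm (a k l) \<le> h (k - l)" and h: "h summable_on UNIV" and c: "c \<in> lp_space \<infinity>"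
  shows "(\<lambda>l. norm (a k l * c l)) summable_on UNIV" and "(\<lambda>l. a k l * c l) summable_on UNIV"
    and "(\<lambda>l. h (k - l) * norm (c l)) summable_on UNIV"
proof -
  from c obtain B where B: "\<And>k. norm (c k) \<le> B" by (auto simp: mem_lp_space_infty)
  have h0: "0 \<le> h s" for s using norm_ge_zero[THEN order_trans, OF a[of s 0]] by simp
  have "(\<lambda>l. h (k - l) * B) summable_on UNIV"
    using summable_on_reindex_bij_betw[OF bij_diff[of k], of h] h by (intro summable_on_cmult_left) simp
  then show *: "(\<lambda>l. h (k - l) * norm (c l)) summable_on UNIV"
    by (rule summable_on_comparison_test) (auto intro!: mult_left_mono mult_nonneg_nonneg h0 B)
  show "(\<lambda>l. norm (a k l * c l)) summable_on UNIV"
    by (rule Infinite_Sum.abs_summable_on_comparison_test'[OF *]) (auto simp: norm_mult intro!: mult_right_mono a)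
  then show "(\<lambda>l. a k l * c l) summable_on UNIV" by (rule abs_summable_summable)
qed

lemma norm_mat_apply_le:
  fixes a :: "'i::ab_group_add \<Rightarrow> 'i \<Rightarrow> complex"
  assumes a: "\<And>k l. norm (a k l) \<le> h (k - l)" and h: "h summable_on UNIV" and c: "c \<in> lp_space \<infinity>"
  shows "norm (mat_apply a c k) \<le> conv h (\<lambda>l. norm (c l)) k"
proof -
  note s = summable_on_mat_apply[of a h c k, OF a h c]
  have "norm (mat_apply a c k) \<le> (\<Sum>\<^sub>\<infinity>l. norm (a k l * c l))"
    unfolding mat_apply_def by (rule norm_infsum_bound[OF s(1)])
  also have "\<dots> \<le> (\<Sum>\<^sub>\<infinity>l. h (k - l) * norm (c l))"
    by (intro infsum_mono s) (auto simp: norm_mult intro!: mult_right_mono a)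
  finally show ?thesis by (simp add: conv_flip)
qed

text \<open>Boundedness of the matrix on \<open>\<ell>\<^sup>q\<close> is Young's inequality for the kernel \<open>h\<close>.\<close>
lemma mat_apply_mem_lp_space:
  fixes a :: "'i::ab_group_add \<Rightarrow> 'i \<Rightarrow> complex"
  assumes p0: "0 < p0" "p0 \<le> 1" and q: "ereal p0 \<le> q"
    and h: "(\<lambda>s. h s powr p0) summable_on UNIV" and a: "\<And>k l. norm (a k l) \<le> h (k - l)"
    and c: "c \<in> lp_space q"
  shows "mat_apply a c \<in> lp_space q"
proof -
  have q0: "0 < q" using p0 q by (metis ereal_less(2) less_le_trans)
  have h0: "0 \<le> h s" for s using norm_ge_zero[THEN order_trans, OF a[of s 0]] by simp
  have hsum: "h summable_on UNIV" using summable_on_powr_mono[OF h0 h p0] by (simp add: h0)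
  have "(\<lambda>s. h s powr subexp q) summable_on UNIV"
    by (rule summable_on_powr_mono[OF h0 h p0(1) subexp_ge[OF p0 q]])
  moreover have "norm (mat_apply a c k) \<le> conv h (\<lambda>l. norm (c l)) k" for k
    by (rule norm_mat_apply_le[of a h c k, OF a hsum lp_space_subset_infty[OF q0 c]])
  ultimately show ?thesis
    by (rule lp_mass_conv(1)[OF q0 c h0])
qed

section \<open>Cubes and windows on the lattice\<close>

text \<open>The supremum norm on the lattice. Its balls are cubes, which is what makes \<open>window_cover\<close> so simple.\<close>
definition vmax :: "int ^ 'd \<Rightarrow> real" where
  "vmax s = Max (range (\<lambda>i. real_of_int \<bar>s $ i\<bar>))"

lemma vmax_le_iff: "vmax s \<le> R \<longleftrightarrow> (\<forall>i. real_of_int \<bar>s $ i\<bar> \<le> R)"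
  unfolding vmax_def by (subst Max_le_iff) auto

lemma component_le_vmax: "real_of_int \<bar>s $ i\<bar> \<le> vmax s"
  using vmax_le_iff[of s "vmax s"] by simp

lemma vmax_nonneg: "0 \<le> vmax s"
  using component_le_vmax[of s undefined] by linarith

lemma vmax_zero: "vmax (0 :: int ^ 'd) = 0"
  using vmax_le_iff[of "0 :: int ^ 'd" 0] vmax_nonneg[of "0 :: int ^ 'd"] by simp

lemma vmax_minus_commute: "vmax (s - t) = vmax (t - s)"
  by (simp add: vmax_def abs_minus_commute)

lemma vmax_triangle: "vmax (s + t) \<le> vmax s + vmax t"
proof -
  have "real_of_int \<bar>(s + t) $ i\<bar> \<le> vmax s + vmax t" for i
    using component_le_vmax[of s i] component_le_vmax[of t i] abs_triangle_ineq[of "s $ i" "t $ i"] 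
    by simp
  then show ?thesis by (simp add: vmax_le_iff)
qed

lemma finite_vmax_le: "finite {s :: int ^ 'd. vmax s \<le> R}"
proof -
  have "vec_nth ` {s :: int ^ 'd. vmax s \<le> R} \<subseteq> UNIV \<rightarrow>\<^sub>E {-\<lceil>R\<rceil>..\<lceil>R\<rceil>}"
  proof (clarsimp simp: PiE_iff vmax_le_iff)
    fix s :: "int ^ 'd" and i
    assume "\<forall>i. \<bar>real_of_int (s $ i)\<bar> \<le> R"
    then have "real_of_int \<bar>s $ i\<bar> \<le> R" by simp
    then have "\<bar>s $ i\<bar> \<le> \<lceil>R\<rceil>" by linarith
    then show "- \<lceil>R\<rceil> \<le> s $ i \<and> s $ i \<le> \<lceil>R\<rceil>" by linarith
  qed
  moreover have "finite ((UNIV :: 'd set) \<rightarrow>\<^sub>E {-\<lceil>R\<rceil>..\<lceil>R\<rceil>})" by (intro finite_PiE) auto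
  ultimately have "finite (vec_nth ` {s :: int ^ 'd. vmax s \<le> R})" by (rule finite_subset)
  then show ?thesis by (rule finite_imageD) (auto simp: inj_on_def vec_nth_inject)
qed

text \<open>A cut-off function with a trapezoidal profile: \<open>1\<close> on the cube of radius \<open>N\<close>, \<open>0\<close> outside the cube of
  radius \<open>2 N\<close>, and Lipschitz with constant \<open>1 / N\<close> in between.\<close>
definition window :: "nat \<Rightarrow> int ^ 'd \<Rightarrow> real" where
  "window N j = max 0 (min 1 (2 - vmax j / N))"

lemma window_bounds: "0 \<le> window N j" "window N j \<le> 1" "\<bar>window N j\<bar> = window N j"
  by (auto simp: window_def)

lemma window_eq_0: "0 < N \<Longrightarrow> 2 * N < vmax j \<Longrightarrow> window N j = 0"
  by (simp add: window_def field_simps)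

lemma window_eq_1: "0 < N \<Longrightarrow> vmax j \<le> N \<Longrightarrow> window N j = 1"
  by (simp add: window_def field_simps)

lemma window_lipschitz:
  assumes "0 < N"
  shows "\<bar>window N i - window N j\<bar> \<le> min 1 (vmax (i - j) / N)"
proof -
  have "vmax i \<le> vmax (i - j) + vmax j" "vmax j \<le> vmax (i - j) + vmax i"
    using vmax_triangle[of "i - j" j] vmax_triangle[of "j - i" i] by (auto simp: vmax_minus_commute)
  then have "\<bar>vmax i / N - vmax j / N\<bar> \<le> vmax (i - j) / N"
    using assms by (simp add: abs_le_iff field_simps)
  then show ?thesis unfolding window_def by linarith
qed

definition signs :: "(int ^ 'd) set" where
  "signs = {e. \<forall>i. e $ i = 1 \<or> e $ i = -1}"

lemma finite_signs: "finite (signs :: (int ^ 'd) set)"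
proof (rule finite_subset[OF _ finite_vmax_le[of 1]])
  have "\<bar>e $ i\<bar> = 1" if "e \<in> signs" for e :: "int ^ 'd" and i
  proof -
    have "e $ i = 1 \<or> e $ i = -1" using that by (simp add: signs_def)
    then show ?thesis by linarith
  qed
  then show "(signs :: (int ^ 'd) set) \<subseteq> {s. vmax s \<le> 1}"
    by (auto simp: vmax_le_iff simp flip: of_int_abs)
qed

text \<open>The cube of radius \<open>2 N\<close> is the union of the \<open>2\<^sup>d\<close> cubes of radius \<open>N\<close> centred at the points with all
  coordinates \<open>N\<close> or \<open>-N\<close>. This allows a window of double size to be estimated by windows of the original
  size, so that the local estimate closes up.\<close>
lemma window_cover:
  fixes j :: "int ^ 'd"
  assumes N: "0 < N" and j: "vmax j \<le> 2 * N"
  shows "1 \<le> (\<Sum>e\<in>signs. window N (j - (\<chi> i. int N * e $ i)))"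
proof -
  define e :: "int ^ 'd" where "e = (\<chi> i. if 0 \<le> j $ i then 1 else -1)"
  have e: "e \<in> signs" by (simp add: signs_def e_def)
  have "real_of_int \<bar>(j - (\<chi> i. int N * e $ i)) $ i\<bar> \<le> N" for i
  proof -
    have "real_of_int \<bar>j $ i\<bar> \<le> real (2 * N)" using j vmax_le_iff by auto
    then have "\<bar>j $ i\<bar> \<le> 2 * int N" by linarith
    then have "\<bar>(j - (\<chi> i. int N * e $ i)) $ i\<bar> \<le> int N" 
      unfolding e_def by (simp, arith)
    then show ?thesis by linarith
  qed
  then have "window N (j - (\<chi> i. int N * e $ i)) = 1"
    by (intro window_eq_1 N) (simp add: vmax_le_iff)
  then show ?thesis
    using member_le_sum[OF e, of "\<lambda>e. window N (j - (\<chi> i. int N * e $ i))"] 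
    by (simp add: window_bounds finite_signs)
qed

text \<open>Dominated convergence: the damping factor tends to \<open>0\<close> for each fixed \<open>s\<close> as \<open>N\<close> grows. This is the only
  source of smallness in the proof.\<close>
lemma infsum_damped_small:
  fixes h :: "int ^ 'd \<Rightarrow> real"
  assumes h: "\<And>s. 0 \<le> h s" and sum: "(\<lambda>s. h s powr p) summable_on UNIV" and p: "0 < p" and \<eta>: "0 < \<eta>"
  obtains N :: nat where "0 < N" "(\<Sum>\<^sub>\<infinity>s. (h s * min 1 (vmax s / N)) powr p) < \<eta>"
proof -
  obtain F where F: "finite F" and "dist (\<Sum>s\<in>F. h s powr p) (\<Sum>\<^sub>\<infinity>s. h s powr p) \<le> \<eta> / 2"
    using infsum_finite_approximation[OF sum, of "\<eta> / 2"] \<eta> by auto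
  moreover have "(\<Sum>\<^sub>\<infinity>s. h s powr p) = (\<Sum>s\<in>F. h s powr p) + (\<Sum>\<^sub>\<infinity>s\<in>-F. h s powr p)"
    using infsum_Un_disjoint[of "\<lambda>s. h s powr p" F "-F"] F summable_on_subset_banach[OF sum] by simp
  ultimately have tail: "(\<Sum>\<^sub>\<infinity>s\<in>-F. h s powr p) \<le> \<eta> / 2" by (simp add: dist_real_def)
  define H where "H = (\<lambda>(N::nat) s. (h s * min 1 (vmax s / N)) powr p)"
  have H: "H N s \<le> h s powr p" for N s
    unfolding H_def using h[of s] p vmax_nonneg[of s]
    by (intro powr_mono2) (auto intro: mult_left_le)
  have "(\<lambda>N. \<Sum>s\<in>F. H N s) \<longlonglongrightarrow> (\<Sum>s\<in>F. (h s * min 1 0) powr p)"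
    unfolding H_def using p h vmax_nonneg
    by (intro tendsto_sum tendsto_powr' tendsto_mult tendsto_min tendsto_const lim_const_over_n) 
       (auto intro!: always_eventually mult_nonneg_nonneg divide_nonneg_nonneg)
  then have "(\<lambda>N. \<Sum>s\<in>F. H N s) \<longlonglongrightarrow> 0" by simp
  from order_tendstoD(2)[OF this, of "\<eta> / 2"] \<eta>
  have "\<forall>\<^sub>F N in sequentially. (\<Sum>s\<in>F. H N s) < \<eta> / 2 \<and> 0 < N" 
    by (intro eventually_conj eventually_gt_at_top) simp
  then obtain N where N: "(\<Sum>s\<in>F. H N s) < \<eta> / 2" "0 < N"
    by (metis (mono_tags, lifting) eventually_sequentially order_refl)
  have sumH: "H N summable_on UNIV"
    by (rule summable_on_comparison_test[OF sum]) (use H in \<open>auto simp: H_def\<close>)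
  have "(\<Sum>\<^sub>\<infinity>s. H N s) = (\<Sum>s\<in>F. H N s) + (\<Sum>\<^sub>\<infinity>s\<in>-F. H N s)"
    using infsum_Un_disjoint[of "H N" F "-F"] F summable_on_subset_banach[OF sumH] by simp
  also have "(\<Sum>\<^sub>\<infinity>s\<in>-F. H N s) \<le> (\<Sum>\<^sub>\<infinity>s\<in>-F. h s powr p)"
    by (intro infsum_mono H summable_on_subset_banach[OF sumH] summable_on_subset_banach[OF sum]) auto
  finally show ?thesis using that[OF N(2)] N(1) tail by (simp add: H_def)
qed

section \<open>Localised lower bounds\<close>

definition local_mass :: "ereal \<Rightarrow> nat \<Rightarrow> (int ^ 'd \<Rightarrow> complex) \<Rightarrow> int ^ 'd \<Rightarrow> real" where
  "local_mass p N c k = lp_mass p (\<lambda>j. complex_of_real (window N (j - k)) * c j)"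

lemma finite_window_support: "finite {j :: int ^ 'd. vmax (j - k) \<le> R}"
proof -
  have "{j. vmax (j - k) \<le> R} \<subseteq> (\<lambda>s. s + k) ` {s. vmax s \<le> R}"
  proof
    fix j assume "j \<in> {j. vmax (j - k) \<le> R}"
    then show "j \<in> (\<lambda>s. s + k) ` {s. vmax s \<le> R}"
      by (intro image_eqI[of _ _ "j - k"]) auto
  qed
  then show ?thesis by (rule finite_subset) (simp add: finite_vmax_le)
qed

lemma windowed_mem_lp_space:
  fixes f :: "int ^ 'd \<Rightarrow> complex"
  assumes "0 < p" "0 < N"
  shows "(\<lambda>j. complex_of_real (window N (j - k)) * f j) \<in> lp_space p"
  by (rule lp_mass_finite_support(1)[OF assms(1) finite_window_support[of k "2 * N"]])
     (simp add: window_eq_0 assms(2))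

text \<open>Crude, but sufficient on the side of the data, where constants may depend on \<open>N\<close>.\<close>
lemma local_mass_le_sum:
  fixes f :: "int ^ 'd \<Rightarrow> complex"
  assumes p: "0 < p" and N: "0 < N"
  shows "local_mass p N f k \<le> (\<Sum>j | vmax (j - k) \<le> 2 * N. norm (f j) powr subexp p)"
proof -
  let ?E = "{j. vmax (j - k) \<le> 2 * N}"
  have "local_mass p N f k 
          \<le> (\<Sum>j\<in>?E. norm (complex_of_real (window N (j - k)) * f j) powr subexp p)"
    unfolding local_mass_def
    by (rule lp_mass_finite_support(2)[OF p finite_window_support]) (simp add: window_eq_0 N)
  also have "\<dots> \<le> (\<Sum>j\<in>?E. norm (f j) powr subexp p)"
    using subexp_bounds[OF p]
    by (intro sum_mono powr_mono2) (auto simp: norm_mult window_bounds intro: mult_left_le_one_le)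
  finally show ?thesis .
qed

lemma local_mass_bounded:
  fixes f :: "int ^ 'd \<Rightarrow> complex"
  assumes p: "0 < p" and N: "0 < N" and f: "f \<in> lp_space \<infinity>"
  obtains B where "0 \<le> B" "\<And>k. local_mass p N f k \<le> B"
proof -
  obtain M where M: "\<And>j. norm (f j) \<le> M" using f by (auto simp: mem_lp_space_infty)
  have "local_mass p N f k \<le> card {j :: int ^ 'd. vmax j \<le> 2 * N} * M powr subexp p" for k
  proof -
    have "local_mass p N f k \<le> (\<Sum>j | vmax (j - k) \<le> 2 * N. M powr subexp p)"
      using M subexp_bounds[OF p]
      by (intro order_trans[OF local_mass_le_sum[OF p N]] sum_mono powr_mono2) auto
    also have "\<dots> = (\<Sum>j | vmax (j :: int ^ 'd) \<le> 2 * N. M powr subexp p)"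
      by (rule sum.reindex_bij_witness[where i = "\<lambda>s. s + k" and j = "\<lambda>j. j - k"]) auto
    finally show ?thesis by simp
  qed
  then show ?thesis using that[of "card {j :: int ^ 'd. vmax j \<le> 2 * N} * M powr subexp p"] by simp
qed

text \<open>The local form of the lower bound. Applied to \<open>f = \<psi>\<^sub>k c\<close>, the lower bound leaves \<open>\<psi>\<^sub>k (A c)\<close> and the
  commutator \<open>\<Phi>\<close>, which is a sum of diagonals \<open>\<phi> s\<close>. After translation by \<open>s\<close> the \<open>s\<close>-th diagonal is
  \<open>\<psi> s\<close>. Its window difference is at most \<open>min 1 (\<bar>s\<bar> / N)\<close>, and it vanishes unless \<open>j\<close> is within \<open>2 N\<close> of \<open>k\<close>
  or of \<open>k - s\<close>. Hence by \<open>window_cover\<close> the mass of \<open>\<psi> s\<close> is at most \<open>H s * T s\<close>, where \<open>T s\<close> collects the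
  local masses at \<open>k\<close> and \<open>k - s\<close>, moved to the neighbouring windows. Summation over \<open>s\<close> produces the two
  terms with \<open>infsum H UNIV\<close> and with \<open>conv H\<close>.\<close>
lemma local_mass_commutator:
  fixes a :: "int ^ 'd \<Rightarrow> int ^ 'd \<Rightarrow> complex"
  assumes p: "0 < p" and N: "0 < N"
    and a: "\<And>k l. norm (a k l) \<le> h (k - l)" 
    and hr: "(\<lambda>s. h s powr subexp p) summable_on UNIV"
    and C: "0 < C" and lower: "\<And>f. f \<in> lp_space p \<Longrightarrow> C * lp_norm p f \<le> lp_norm p (mat_apply a f)"
    and c: "c \<in> lp_space \<infinity>"
    and H: "H = (\<lambda>s. (h s * min 1 (vmax s / N)) powr subexp p)"
  shows "local_mass p N c k \<le> (1 / C) powr subexp p * (local_mass p N (mat_apply a c) k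
      + (\<Sum>e\<in>signs. infsum H UNIV * local_mass p N c (k + (\<chi> i. int N * e $ i))
                  + conv H (local_mass p N c) (k + (\<chi> i. int N * e $ i))))"
proof -
  let ?r = "subexp p" and ?X = "local_mass p N c" and ?m = "\<lambda>e :: int ^ 'd. \<chi> i. int N * e $ i"
  let ?w = "window N :: int ^ 'd \<Rightarrow> real"
  have r: "0 < ?r" "?r \<le> 1" using subexp_bounds[OF p] by auto
  have h0: "0 \<le> h s" for s using norm_ge_zero[THEN order_trans, OF a[of s 0]] by simp
  have hsum: "h summable_on UNIV"
    using summable_on_powr_mono[of h ?r UNIV 1] hr h0 r by simp
  have Hle: "H s \<le> h s powr ?r" and H0: "0 \<le> H s" for s
    unfolding H using h0[of s] vmax_nonneg[of s] r by (auto intro!: powr_mono2 mult_left_le)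
  have Hsum: "H summable_on UNIV"
    by (rule summable_on_comparison_test[OF hr]) (use Hle H0 in auto)
  obtain B where B: "0 \<le> B" "\<And>k. ?X k \<le> B" using local_mass_bounded[OF p N c] by blast
  have X0: "0 \<le> ?X k" for k by (simp add: local_mass_def)
  have aX: "\<bar>?X k\<bar> \<le> B" for k using B X0 by simp
  define f where "f = (\<lambda>j. complex_of_real (?w (j - k)) * c j)"
  have f: "f \<in> lp_space p" unfolding f_def by (rule windowed_mem_lp_space[OF p N])
  have finf: "f \<in> lp_space \<infinity>" by (rule lp_space_subset_infty[OF p f])

  define \<psi> where "\<psi> = (\<lambda>s j. h s * \<bar>?w (j - k) - ?w (j + s - k)\<bar> * norm (c j))"
  define \<phi> where "\<phi> = (\<lambda>s j. \<psi> s (j - s))"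
  define \<Phi> where "\<Phi> = (\<lambda>j. \<Sum>\<^sub>\<infinity>s. \<phi> s j)"
  define T where "T = (\<lambda>s. \<Sum>e\<in>signs. ?X (k + ?m e) + ?X (k + ?m e - s))"
  have \<psi>: "\<psi> s \<in> lp_space p \<and> lp_mass p (\<psi> s) \<le> H s * T s" for s
  proof -
    define g where "g = (\<lambda>e j. complex_of_real (?w (j - (k + ?m e)) + ?w (j - (k + ?m e - s))) * c j)"
    have g: "g e \<in> lp_space p \<and> lp_mass p (g e) \<le> ?X (k + ?m e) + ?X (k + ?m e - s)" for e
      using lp_mass_add_le[OF p windowed_mem_lp_space[OF p N, of "k + ?m e" c] 
          windowed_mem_lp_space[OF p N, of "k + ?m e - s" c], of "g e"]
      by (simp add: g_def local_mass_def distrib_right norm_triangle_ineq)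
    define W where "W = (\<lambda>j. \<Sum>e\<in>signs. norm (g e j))"
    have W: "W \<in> lp_space p" "lp_mass p W \<le> T s"
    proof -
      have "lp_mass p W \<le> (\<Sum>e\<in>signs. lp_mass p (g e))" and "W \<in> lp_space p"
        using lp_mass_sum_le[of p signs g W] p g finite_signs by (auto simp: W_def sum_nonneg)
      moreover have "(\<Sum>e\<in>signs. lp_mass p (g e)) \<le> T s"
        unfolding T_def using g by (intro sum_mono) auto
      ultimately show "W \<in> lp_space p" "lp_mass p W \<le> T s" by auto
    qed
    have "norm (\<psi> s j) \<le> (h s * min 1 (vmax s / N)) * norm (W j)" for j
    proof -
      have normW: "norm (W j) = W j" by (simp add: W_def sum_nonneg)
      have "norm (g e j) = (?w (j - k - ?m e) + ?w (j + s - k - ?m e)) * norm (c j)" for e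
      proof -
        have "j - (k + ?m e) = j - k - ?m e" "j - (k + ?m e - s) = j + s - k - ?m e"
          by (simp_all add: algebra_simps)
        then have "g e j = complex_of_real (?w (j - k - ?m e) + ?w (j + s - k - ?m e)) * c j"
          by (simp only: g_def)
        then show ?thesis
          by (simp only: norm_mult norm_of_real abs_of_nonneg add_nonneg_nonneg window_bounds)
      qed
      then have Weq: "W j = (\<Sum>e\<in>signs. ?w (j - k - ?m e) + ?w (j + s - k - ?m e)) * norm (c j)"
        by (simp only: W_def sum_distrib_right)
      have "\<bar>?w (j - k) - ?w (j + s - k)\<bar> 
              \<le> min 1 (vmax s / N) * (\<Sum>e\<in>signs. ?w (j - k - ?m e) + ?w (j + s - k - ?m e))"
      \<comment> \<open>If both points lie outside the cube of radius \<open>2 N\<close>, both window values vanish.\<close>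
      proof (cases "vmax (j - k) \<le> 2 * N \<or> vmax (j + s - k) \<le> 2 * N")
        case True
        have "0 \<le> (\<Sum>e\<in>signs. ?w (j - k - ?m e))" "0 \<le> (\<Sum>e\<in>signs. ?w (j + s - k - ?m e))"
          by (auto intro: sum_nonneg simp: window_bounds)
        then have "1 \<le> (\<Sum>e\<in>signs. ?w (j - k - ?m e) + ?w (j + s - k - ?m e))"
          using True window_cover[OF N, of "j - k"] window_cover[OF N, of "j + s - k"]
          by (auto simp: sum.distrib)
        moreover have "\<bar>?w (j - k) - ?w (j + s - k)\<bar> \<le> min 1 (vmax s / N)"
          using window_lipschitz[OF N, of "j + s - k" "j - k"] by (simp add: abs_minus_commute)
        moreover have "0 \<le> min 1 (vmax s / N)" using vmax_nonneg[of s] by simp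
        ultimately show ?thesis 
          using mult_left_mono[of 1 "\<Sum>e\<in>signs. ?w (j - k - ?m e) + ?w (j + s - k - ?m e)" "min 1 (vmax s / N)"]
          by linarith
      next
        case False
        then have "?w (j - k) = 0" "?w (j + s - k) = 0" 
          using window_eq_0[OF N, of "j - k"] window_eq_0[OF N, of "j + s - k"] by auto
        then show ?thesis using vmax_nonneg[of s] 
          by (auto intro!: sum_nonneg mult_nonneg_nonneg add_nonneg_nonneg simp: window_bounds)
      qed
      then have "h s * \<bar>?w (j - k) - ?w (j + s - k)\<bar> * norm (c j) \<le> 
        h s * (min 1 (vmax s / N) * (\<Sum>e\<in>signs. ?w (j - k - ?m e) + ?w (j + s - k - ?m e))) * norm (c j)"
        by (intro mult_right_mono mult_left_mono h0) auto
      then show ?thesis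
        unfolding normW unfolding Weq using h0[of s] by (simp add: \<psi>_def abs_mult mult.assoc)
    qed
    from lp_mass_dominated[OF p W(1) _ this] h0[of s] vmax_nonneg[of s]
    have "\<psi> s \<in> lp_space p" "lp_mass p (\<psi> s) \<le> H s * lp_mass p W" by (auto simp: H)
    with mult_left_mono[OF W(2) H0[of s]] show ?thesis by simp
  qed
  then have \<phi>: "\<phi> s \<in> lp_space p" "lp_mass p (\<phi> s) \<le> H s * T s" "0 \<le> \<phi> s j" for s j
    unfolding \<phi>_def by (auto simp: lp_mass_shift) (simp add: \<psi>_def h0)

  have convX: "(\<lambda>s. H s * ?X (k' - s)) summable_on UNIV" for k'
    by (rule summable_on_conv[OF Hsum H0 aX])
  have HTs: "(\<lambda>s. H s * ?X (k + ?m e) + H s * ?X (k + ?m e - s)) summable_on UNIV" for e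
    by (intro summable_on_add convX summable_on_cmult_left Hsum)
  have HTeq: "H s * T s = (\<Sum>e\<in>signs. H s * ?X (k + ?m e) + H s * ?X (k + ?m e - s))" for s
    by (simp add: T_def sum_distrib_left distrib_left)
  have "((\<lambda>s. H s * T s) has_sum 
          (\<Sum>e\<in>signs. infsum H UNIV * ?X (k + ?m e) + conv H ?X (k + ?m e))) UNIV"
  proof -
    have "((\<lambda>s. H s * ?X (k + ?m e) + H s * ?X (k + ?m e - s)) has_sum 
            infsum H UNIV * ?X (k + ?m e) + conv H ?X (k + ?m e)) UNIV" for e
      unfolding conv_def by (intro has_sum_add has_sum_cmult_left has_sum_infsum Hsum convX)
    then show ?thesis 
      unfolding HTeq using finite_signs by (intro has_sum_finite_sum)
  qed
  then have HT: "(\<lambda>s. H s * T s) summable_on UNIV" 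
    and HTinf: "(\<Sum>\<^sub>\<infinity>s. H s * T s) = (\<Sum>e\<in>signs. infsum H UNIV * ?X (k + ?m e) + conv H ?X (k + ?m e))"
    by (auto simp: has_sum_iff)
  have sum\<phi>: "(\<lambda>s. lp_mass p (\<phi> s)) summable_on UNIV"
    by (rule summable_on_comparison_test[OF HT]) (use \<phi> in auto)
  have \<Phi>: "\<Phi> \<in> lp_space p" "lp_mass p \<Phi> \<le> (\<Sum>\<^sub>\<infinity>s. H s * T s)"
  proof -
    have "norm (\<Phi> j) \<le> (\<Sum>\<^sub>\<infinity>s. \<phi> s j)" for j
      unfolding \<Phi>_def using \<phi>(3) by (simp add: infsum_nonneg)
    note * = lp_mass_subadditive[of p UNIV \<phi> \<Phi>, OF p \<phi>(1) \<phi>(3) sum\<phi> this]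
    show "\<Phi> \<in> lp_space p" using * by simp
    show "lp_mass p \<Phi> \<le> (\<Sum>\<^sub>\<infinity>s. H s * T s)"
      using *(2) infsum_mono[OF sum\<phi> HT \<phi>(2)] by linarith
  qed

  have pointwise: "norm (mat_apply a f i) 
      \<le> norm (complex_of_real (?w (i - k)) * mat_apply a c i) + norm (\<Phi> i)" for i
  proof -
    note sf = summable_on_mat_apply[of a h f i, OF a hsum finf]
    note sc = summable_on_mat_apply[of a h c i, OF a hsum c]
    define \<delta> where "\<delta> = (\<lambda>l. ?w (l - k) - ?w (i - k))"
    have bound: "norm (a i l * (complex_of_real (\<delta> l) * c l)) \<le> h (i - l) * (\<bar>\<delta> l\<bar> * norm (c l))" for l
      by (auto simp: norm_mult intro!: mult_right_mono a)
    have "(\<lambda>l. h (i - l) * (\<bar>\<delta> l\<bar> * norm (c l))) summable_on UNIV"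
    proof (rule summable_on_comparison_test[OF sc(3)])
      fix l
      have "\<bar>\<delta> l\<bar> \<le> 1" unfolding \<delta>_def using window_lipschitz[OF N, of "l - k" "i - k"] by simp
      then show "h (i - l) * (\<bar>\<delta> l\<bar> * norm (c l)) \<le> h (i - l) * norm (c l)"
        by (intro mult_left_mono h0 mult_left_le_one_le) auto
    qed (simp add: h0)
    note s\<delta> = this
    have sn: "(\<lambda>l. norm (a i l * (complex_of_real (\<delta> l) * c l))) summable_on UNIV"
      by (rule Infinite_Sum.abs_summable_on_comparison_test'[OF s\<delta>]) (use bound in auto)
    have "mat_apply a f i = (\<Sum>\<^sub>\<infinity>l. complex_of_real (?w (i - k)) * (a i l * c l) 
                                + a i l * (complex_of_real (\<delta> l) * c l))"
      unfolding mat_apply_def f_def \<delta>_def by (intro infsum_cong) (simp add: algebra_simps)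
    also have "\<dots> = complex_of_real (?w (i - k)) * mat_apply a c i 
                    + (\<Sum>\<^sub>\<infinity>l. a i l * (complex_of_real (\<delta> l) * c l))"
      unfolding mat_apply_def 
      by (subst infsum_add) (auto intro: summable_on_cmult_right sc abs_summable_summable[OF sn] 
          simp: infsum_cmult_right')
    finally have "norm (mat_apply a f i) \<le> norm (complex_of_real (?w (i - k)) * mat_apply a c i) 
                    + norm (\<Sum>\<^sub>\<infinity>l. a i l * (complex_of_real (\<delta> l) * c l))"
      by (simp add: norm_triangle_ineq)
    also have "norm (\<Sum>\<^sub>\<infinity>l. a i l * (complex_of_real (\<delta> l) * c l)) 
                 \<le> (\<Sum>\<^sub>\<infinity>l. h (i - l) * (\<bar>\<delta> l\<bar> * norm (c l)))"
      using norm_infsum_bound[OF sn] infsum_mono[OF sn s\<delta> bound] by linarith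
    also have "\<dots> = \<Phi> i"
      unfolding \<Phi>_def \<phi>_def \<psi>_def \<delta>_def
      using infsum_reindex_bij_betw[OF bij_diff[of i], 
          of "\<lambda>l. h (i - l) * (\<bar>?w (l - k) - ?w (i - k)\<bar> * norm (c l))"]
      by (simp add: mult.assoc)
    finally show ?thesis by simp
  qed
  have Af: "lp_mass p (mat_apply a f) \<le> local_mass p N (mat_apply a c) k + lp_mass p \<Phi>"
    using lp_mass_add_le(2)[OF p windowed_mem_lp_space[OF p N] \<Phi>(1) pointwise] 
    by (simp add: local_mass_def)

  have "lp_norm p f \<le> 1 / C * lp_norm p (mat_apply a f)"
    using lower[OF f] C by (simp add: field_simps)
  moreover have "0 \<le> lp_norm p (mat_apply a f)"
    using lower[OF f] C lp_norm_nonneg[OF p f] by (meson less_imp_le mult_nonneg_nonneg order_trans)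
  ultimately have "lp_mass p f \<le> (1 / C) powr ?r * lp_mass p (mat_apply a f)"
    using lp_norm_nonneg[OF p f] C r unfolding lp_mass_def by (subst powr_mult[symmetric]) (auto intro!: powr_mono2)
  also have "\<dots> \<le> (1 / C) powr ?r * (local_mass p N (mat_apply a c) k + (\<Sum>\<^sub>\<infinity>s. H s * T s))"
    using Af \<Phi> by (intro mult_left_mono) auto
  finally show ?thesis by (simp add: HTinf f_def local_mass_def)
qed

text \<open>The local estimate has the form \<open>X \<le> K Z + G * X\<close>, where \<open>G\<close> is \<open>K\<close> times the sum of \<open>2\<^sup>d\<close> translates of
  \<open>L = H + \<epsilon> \<delta>\<close> with \<open>\<epsilon> = \<Sum> H\<close>. The exponent \<open>\<theta> = p0 / r\<close> is chosen so that
  \<open>H\<^sup>\<theta> = (h s * min 1 (\<bar>s\<bar> / N))\<^sup>p\<^sup>0\<close>, whose sum is small for large \<open>N\<close>. The kernel \<open>v\<close> is the Neumann kernel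
  of \<open>G\<close> convolved with \<open>K\<close> times the indicator of the cube of radius \<open>2 N\<close>, because \<open>Z\<close> is bounded by the
  convolution of \<open>\<bar>A c\<bar>\<^sup>r\<close> with this indicator.\<close>
lemma lower_bound_imp_pointwise_bound:
  fixes a :: "int ^ 'd \<Rightarrow> int ^ 'd \<Rightarrow> complex"
  assumes p0: "0 < p0" "p0 \<le> 1" and p: "ereal p0 \<le> p"
    and h: "(\<lambda>s. h s powr p0) summable_on UNIV" and a: "\<And>k l. norm (a k l) \<le> h (k - l)"
    and C: "0 < C" and lower: "\<And>f. f \<in> lp_space p \<Longrightarrow> C * lp_norm p f \<le> lp_norm p (mat_apply a f)"
  shows "\<exists>v. (\<forall>k. 0 \<le> v k) \<and> (\<lambda>k. v k powr (p0 / subexp p)) summable_on UNIV \<and>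
    (\<forall>c\<in>lp_space \<infinity>. \<forall>k.
       norm (c k) powr subexp p \<le> conv v (\<lambda>l. norm (mat_apply a c l) powr subexp p) k)"
proof -
  let ?r = "subexp p"
  define \<theta> where "\<theta> = p0 / ?r"
  have pp: "0 < p" using p0 p by (metis ereal_less(2) less_le_trans)
  have r: "0 < ?r" "?r \<le> 1" "p0 \<le> ?r" using subexp_bounds[OF pp] subexp_ge[OF p0 p] by auto
  have \<theta>: "0 < \<theta>" "\<theta> \<le> 1" "?r * \<theta> = p0" using p0 r by (auto simp: \<theta>_def)
  let ?t = "ereal \<theta>"
  have t0: "0 < ?t" and subt: "subexp ?t = \<theta>" using \<theta> by auto
  have mass: "lp_mass ?t f = (\<Sum>\<^sub>\<infinity>k. norm (f k) powr \<theta>)" for f :: "int ^ 'd \<Rightarrow> real"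
    using \<theta> by (simp add: lp_mass_real infsum_nonneg)
  have h0: "0 \<le> h s" for s using norm_ge_zero[THEN order_trans, OF a[of s 0]] by simp
  have hr: "(\<lambda>s. h s powr ?r) summable_on UNIV"
    by (rule summable_on_powr_mono[OF h0 h p0(1) r(3)])
  define K where "K = (1 / C) powr ?r"
  have K: "0 < K" using C by (simp add: K_def)
  define M where "M = card (signs :: (int ^ 'd) set)"
  \<comment> \<open>The factor \<open>2\<close> absorbs the two parts of \<open>L\<close>, and \<open>M + 1\<close> is positive by form, as the strict bound on \<open>G\<close> requires.\<close>
  define \<eta> where "\<eta> = 1 / (2 * K powr \<theta> * (M + 1))"
  have "0 < \<eta>" using K by (simp add: \<eta>_def)
  then obtain N :: nat where N: "0 < N" and small: "(\<Sum>\<^sub>\<infinity>s. (h s * min 1 (vmax s / N)) powr p0) < \<eta>"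
    using infsum_damped_small[OF h0 h p0(1)] by blast
  let ?m = "\<lambda>e :: int ^ 'd. \<chi> i. int N * e $ i"

  define H where "H = (\<lambda>s. (h s * min 1 (vmax s / N)) powr ?r)"
  have H0: "0 \<le> H s" for s by (simp add: H_def)
  have Hpow: "H s powr \<theta> = (h s * min 1 (vmax s / N)) powr p0" for s
    using \<theta>(3) by (simp add: H_def powr_powr)
  have Hpsum: "(\<lambda>s. H s powr \<theta>) summable_on UNIV"
    unfolding Hpow
    by (rule summable_on_comparison_test[OF h])
       (use h0 p0 vmax_nonneg in \<open>auto intro!: powr_mono2 mult_left_le mult_nonneg_nonneg divide_nonneg_nonneg\<close>)
  have Hsum: "H summable_on UNIV" using summable_on_powr_mono[OF H0 Hpsum \<theta>(1,2)] by (simp add: H0)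
  have massH: "H \<in> lp_space ?t" "lp_mass ?t H < \<eta>"
    using Hpsum small by (simp_all add: mem_lp_space_real mass H0 Hpow)
  define \<epsilon> where "\<epsilon> = infsum H UNIV"
  have \<epsilon>: "0 \<le> \<epsilon>" by (simp add: \<epsilon>_def infsum_nonneg H0)
  have \<epsilon>H: "\<epsilon> powr \<theta> \<le> lp_mass ?t H"
    using infsum_powr_le[OF H0 Hpsum \<theta>(1,2)] by (simp add: mass H0 \<epsilon>_def)
  define \<Delta> where "\<Delta> = (\<lambda>s :: int ^ 'd. \<epsilon> * (if s = 0 then 1 else 0))"
  have \<Delta>: "\<Delta> \<in> lp_space ?t" "lp_mass ?t \<Delta> \<le> \<epsilon> powr \<theta>"
    using lp_mass_finite_support[of ?t "{0}" \<Delta>] \<theta> \<epsilon> by (simp_all add: \<Delta>_def)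
  define L where "L = (\<lambda>s. H s + \<Delta> s)"
  have L0: "0 \<le> L s" for s by (simp add: L_def H0 \<Delta>_def \<epsilon>)
  have L: "L \<in> lp_space ?t" "lp_mass ?t L \<le> lp_mass ?t H + \<epsilon> powr \<theta>"
    using lp_mass_add_le[OF t0 massH(1) \<Delta>(1), of L] \<Delta>(2) by (auto simp: L_def abs_triangle_ineq)
  have \<Delta>sum: "\<Delta> summable_on UNIV"
    unfolding \<Delta>_def by (intro summable_on_cmult_right finite_nonzero_values_imp_summable_on) simp
  have Lsum: "L summable_on UNIV" unfolding L_def by (intro summable_on_add Hsum \<Delta>sum)
  define G where "G = (\<lambda>t. K * (\<Sum>e\<in>signs. L (t + ?m e)))"
  have G0: "0 \<le> G t" for t using K by (simp add: G_def sum_nonneg L0)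
  have Lshift: "(\<lambda>t. L (t + s)) \<in> lp_space ?t" "lp_mass ?t (\<lambda>t. L (t + s)) = lp_mass ?t L" for s
    using lp_mass_shift[where f = L and s = "- s" and p = ?t] L by simp_all
  have Lshiftsum: "(\<lambda>t. L (t + s)) summable_on UNIV" for s
    using summable_on_reindex_bij_betw[OF bij_minus[of "- s"], of L] Lsum by simp
  define F where "F = (\<lambda>t. \<Sum>e\<in>signs. L (t + ?m e))"
  have F: "F \<in> lp_space ?t" "lp_mass ?t F \<le> M * lp_mass ?t L"
    using lp_mass_sum_le[of ?t signs "\<lambda>e t. L (t + ?m e)" F] Lshift \<theta> finite_signs
    by (simp_all add: F_def L0 sum_nonneg M_def)
  have G: "G \<in> lp_space ?t" "lp_mass ?t G \<le> K powr \<theta> * lp_mass ?t F"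
    using lp_mass_dominated[OF t0 F(1), of K G] K subt by (simp_all add: G_def F_def abs_mult)
  have "lp_mass ?t G \<le> K powr \<theta> * (M * (2 * lp_mass ?t H))"
    using G(2) F(2) L(2) \<epsilon>H K
    by (intro order_trans[OF G(2)] mult_left_mono order_trans[OF F(2)]) auto
  also have "\<dots> \<le> K powr \<theta> * ((M + 1) * (2 * lp_mass ?t H))"
    by (intro mult_left_mono mult_right_mono) auto
  also have "\<dots> < K powr \<theta> * ((M + 1) * (2 * \<eta>))"
    using massH(2) K by (intro mult_strict_left_mono) auto
  also have "\<dots> = 1" using K by (simp add: \<eta>_def)
  finally have Gsmall: "(\<Sum>\<^sub>\<infinity>s. G s powr \<theta>) < 1" by (simp add: mass G0)
  have Gsum: "(\<lambda>s. G s powr \<theta>) summable_on UNIV" using G(1) by (simp add: mem_lp_space_real G0)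

  obtain u where u0: "\<And>k. 0 \<le> u k" and usum: "(\<lambda>k. u k powr \<theta>) summable_on UNIV"
    and udom: "\<And>x y B k. (\<And>k. 0 \<le> x k \<and> x k \<le> B) \<Longrightarrow> (\<And>k. 0 \<le> y k \<and> y k \<le> B) \<Longrightarrow>
           (\<And>k. x k \<le> y k + conv G x k) \<Longrightarrow> x k \<le> conv u y k"
    using neumann_series_domination[OF G0 \<theta>(1,2) Gsum Gsmall] by blast
  have usum1: "u summable_on UNIV" using summable_on_powr_mono[OF u0 usum \<theta>(1,2)] by (simp add: u0)
  define b where "b = (\<lambda>t :: int ^ 'd. if vmax t \<le> 2 * N then K else 0)"
  have b0: "0 \<le> b t" for t using K by (simp add: b_def)
  have b: "b \<in> lp_space ?t"
    by (rule lp_mass_finite_support(1)[OF t0 finite_vmax_le[of "2 * N"]]) (simp add: b_def)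
  have bsum: "b summable_on UNIV"
    using b summable_on_powr_mono[of b \<theta> UNIV 1] \<theta> by (simp add: mem_lp_space_real b0)
  define v where "v = conv u b"
  have v0: "0 \<le> v k" for k unfolding v_def by (intro conv_nonneg u0 b0)
  have "(\<lambda>l. norm (b l)) = b" using b0 by auto
  then have "norm (v k) \<le> conv u (\<lambda>l. norm (b l)) k" for k using v0[of k] by (simp only: v_def) simp
  from lp_mass_conv(1)[OF t0 b u0 _ this] have "v \<in> lp_space ?t" using usum subt by simp
  then have vsum: "(\<lambda>k. v k powr \<theta>) summable_on UNIV" by (simp add: mem_lp_space_real v0)

  have main: "norm (c k) powr ?r \<le> conv v (\<lambda>l. norm (mat_apply a c l) powr ?r) k" 
    if c: "c \<in> lp_space \<infinity>" for c k
  proof -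
    let ?X = "local_mass p N c" and ?Z = "local_mass p N (mat_apply a c)"
    have Ac: "mat_apply a c \<in> lp_space \<infinity>"
      using mat_apply_mem_lp_space[OF p0 _ h a c] by simp
    obtain B1 where B1: "0 \<le> B1" "\<And>k. ?X k \<le> B1" using local_mass_bounded[OF pp N c] by blast
    obtain B2 where B2: "0 \<le> B2" "\<And>k. ?Z k \<le> B2" using local_mass_bounded[OF pp N Ac] by blast
    have X0: "0 \<le> ?X k" and Z0: "0 \<le> ?Z k" for k by (simp_all add: local_mass_def)
    have aX: "\<bar>?X k\<bar> \<le> B1" for k using B1 X0 by simp
    have KZ: "K * ?Z k \<le> K * B2" for k using B2 K by simp
    have "conv G ?X k = K * (\<Sum>e\<in>signs. conv H ?X (k + ?m e) + \<epsilon> * ?X (k + ?m e))" for k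
    proof -
      have "conv G ?X k = K * (\<Sum>e\<in>signs. conv (\<lambda>t. L (t + ?m e)) ?X k)"
        unfolding G_def conv_cmult_left
        by (subst conv_sum_left[OF finite_signs Lshiftsum _ aX]) (auto simp: L0)
      also have "(\<Sum>e\<in>signs. conv (\<lambda>t. L (t + ?m e)) ?X k) 
          = (\<Sum>e\<in>signs. conv H ?X (k + ?m e) + \<epsilon> * ?X (k + ?m e))"
        unfolding conv_shift unfolding L_def
        by (subst conv_add_left[OF Hsum H0 \<Delta>sum _ aX]) (auto simp: \<Delta>_def conv_cmult_left \<epsilon>)
      finally show ?thesis .
    qed
    moreover have "?X k \<le> K * (?Z k + (\<Sum>e\<in>signs. \<epsilon> * ?X (k + ?m e) + conv H ?X (k + ?m e)))" for k
      unfolding K_def \<epsilon>_def by (rule local_mass_commutator[OF pp N a hr C lower c H_def])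
    ultimately have "?X k \<le> K * ?Z k + conv G ?X k" for k
      by (simp add: distrib_left add.commute)
    moreover have "0 \<le> ?X k \<and> ?X k \<le> max B1 (K * B2)" "0 \<le> K * ?Z k \<and> K * ?Z k \<le> max B1 (K * B2)" for k
      using X0[of k] Z0[of k] B1(2)[of k] KZ[of k] K by (simp_all only: le_max_iff_disj) simp_all
    ultimately have "?X k \<le> conv u (\<lambda>k. K * ?Z k) k"
      by (intro udom[where B = "max B1 (K * B2)"])
    also have "\<dots> \<le> conv u (conv b (\<lambda>l. norm (mat_apply a c l) powr ?r)) k"
    proof -
      obtain B3 where B3: "norm (mat_apply a c l) \<le> B3" for l using Ac by (auto simp: mem_lp_space_infty)
      have yb: "\<bar>norm (mat_apply a c l) powr ?r\<bar> \<le> B3 powr ?r" for l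
        using B3 r by (simp add: powr_mono2)
      have "K * ?Z k \<le> conv b (\<lambda>l. norm (mat_apply a c l) powr ?r) k" for k
      proof -
        have "((\<lambda>l. b (k - l) * norm (mat_apply a c l) powr ?r) has_sum 
                (\<Sum>l | vmax (l - k) \<le> 2 * N. b (k - l) * norm (mat_apply a c l) powr ?r)) UNIV"
          by (rule has_sum_finite_neutralI[OF finite_window_support]) (auto simp: b_def vmax_minus_commute)
        moreover have "(\<Sum>l | vmax (l - k) \<le> 2 * N. b (k - l) * norm (mat_apply a c l) powr ?r)
            = K * (\<Sum>l | vmax (l - k) \<le> 2 * N. norm (mat_apply a c l) powr ?r)"
          unfolding sum_distrib_left by (intro sum.cong) (auto simp: b_def vmax_minus_commute)
        ultimately have "conv b (\<lambda>l. norm (mat_apply a c l) powr ?r) k 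
            = K * (\<Sum>l | vmax (l - k) \<le> 2 * N. norm (mat_apply a c l) powr ?r)"
          by (simp add: conv_flip has_sum_iff)
        then show ?thesis using local_mass_le_sum[OF pp N, of "mat_apply a c" k] K by simp
      qed
      then show ?thesis
        using KZ K Z0 by (intro conv_mono[OF usum1 u0 _ abs_conv_le[OF bsum b0 yb], of _ "K * B2"]) auto
    qed
    also have "\<dots> = conv v (\<lambda>l. norm (mat_apply a c l) powr ?r) k"
    proof -
      obtain B3 where B3: "norm (mat_apply a c l) \<le> B3" for l using Ac by (auto simp: mem_lp_space_infty)
      have yb: "\<bar>norm (mat_apply a c l) powr ?r\<bar> \<le> B3 powr ?r" for l
        using B3 r by (simp add: powr_mono2)
      show ?thesis unfolding v_def by (simp only: conv_assoc[OF usum1 u0 bsum b0 yb])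
    qed
    finally have "?X k \<le> conv v (\<lambda>l. norm (mat_apply a c l) powr ?r) k" .
    moreover have "norm (c k) powr ?r \<le> ?X k"
      using norm_powr_le_lp_mass[OF pp windowed_mem_lp_space[OF pp N, of k c], of k] N
      by (simp add: local_mass_def window_eq_1 vmax_zero)
    ultimately show ?thesis by linarith
  qed
  show ?thesis using v0 vsum main unfolding \<theta>_def by blast
qed

section \<open>Stability and spectral invariance\<close>

text \<open>Young's inequality in \<open>\<ell>\<^sup>q\<^sup>/\<^sup>r\<close>, applied to \<open>\<bar>c\<bar>\<^sup>r\<close> and \<open>\<bar>T c\<bar>\<^sup>r\<close>. The kernel is admissible since
  \<open>p0 / r \<le> min 1 (q / r)\<close>.\<close>
lemma pointwise_bound_imp_lower_bound:
  fixes T :: "('i::ab_group_add \<Rightarrow> complex) \<Rightarrow> 'i \<Rightarrow> complex"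
  assumes p0: "0 < p0" "p0 \<le> r" and q: "ereal p0 \<le> q"
    and v: "\<And>k. 0 \<le> v k" "(\<lambda>k. v k powr (p0 / r)) summable_on UNIV"
    and dom: "\<And>c k. c \<in> lp_space \<infinity> \<Longrightarrow> norm (c k) powr r \<le> conv v (\<lambda>l. norm (T c l) powr r) k"
    and T: "\<And>c. c \<in> lp_space q \<Longrightarrow> T c \<in> lp_space q"
  shows "\<exists>C>0. \<forall>c\<in>lp_space q. C * lp_norm q c \<le> lp_norm q (T c)"
proof -
  have q0: "0 < q" using p0 q by (metis ereal_less(2) less_le_trans)
  have r: "0 < r" using p0 by simp
  define q' where "q' = q / ereal r"
  have q'0: "0 < q'" and "ereal (p0 / r) \<le> q'"
    using q0 q r p0 by (cases q; auto simp: q'_def divide_right_mono)+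
  then have sub: "p0 / r \<le> subexp q'"
    using p0 r by (intro subexp_ge) auto
  define s where "s = r * subexp q'"
  have s: "0 < s" using r subexp_bounds[OF q'0] by (simp add: s_def)
  define V where "V = (\<Sum>\<^sub>\<infinity>k. v k powr subexp q')"
  have V: "0 \<le> V" by (simp add: V_def infsum_nonneg)
  have vs: "(\<lambda>k. v k powr subexp q') summable_on UNIV"
    by (rule summable_on_powr_mono[OF v _ sub]) (use p0 r in simp)
  have "lp_norm q c \<le> V powr (1 / s) * lp_norm q (T c)" if c: "c \<in> lp_space q" for c
  proof -
    note 1 = lp_power[OF r q0 c] and 2 = lp_power[OF r q0 T[OF c]]
    have n: "0 \<le> lp_norm q c" "0 \<le> lp_norm q (T c)" using lp_norm_nonneg[OF q0] c T by auto
    have "lp_mass q' (\<lambda>k. norm (c k) powr r) \<le> V * lp_mass q' (\<lambda>k. norm (T c k) powr r)"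
      unfolding V_def
      by (rule lp_mass_conv(2)[OF q'0 _ v(1) vs]) 
         (use 2 dom[OF lp_space_subset_infty[OF q0 c]] in \<open>simp_all add: q'_def\<close>)
    then have "lp_norm q c powr s \<le> V * lp_norm q (T c) powr s"
      using 1 2 by (simp add: lp_mass_def q'_def powr_powr s_def)
    then have "(lp_norm q c powr s) powr (1 / s) \<le> (V * lp_norm q (T c) powr s) powr (1 / s)"
      using s by (intro powr_mono2) auto
    then show ?thesis using s n V by (simp add: powr_powr powr_mult)
  qed
  note * = this
  \<comment> \<open>Adding \<open>1\<close> avoids a division by zero when the kernel vanishes.\<close>
  have pos: "0 < V powr (1 / s) + 1" by (simp add: add_nonneg_pos)
  show ?thesis
  proof (intro exI[of _ "1 / (V powr (1 / s) + 1)"] conjI ballI)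
    show "0 < 1 / (V powr (1 / s) + 1)" using pos by simp
    fix c :: "'i \<Rightarrow> complex" assume c: "c \<in> lp_space q"
    have "lp_norm q c \<le> (V powr (1 / s) + 1) * lp_norm q (T c)"
      using *[OF c] lp_norm_nonneg[OF q0 T[OF c]] by (simp add: distrib_right)
    then show "1 / (V powr (1 / s) + 1) * lp_norm q c \<le> lp_norm q (T c)"
      using pos by (simp add: field_simps)
  qed
qed

lemma lp_invertible_imp_lower_bound:
  assumes p: "0 < p" and inv: "lp_invertible p T"
  shows "\<exists>C>0. \<forall>c\<in>lp_space p. C * lp_norm p c \<le> lp_norm p (T c)"
proof -
  have bij: "bij_betw T (lp_space p) (lp_space p)" using inv by (simp add: lp_invertible_def)
  obtain B where B: "\<And>c. c \<in> lp_space p \<Longrightarrow> lp_norm p (inv_into (lp_space p) T c) \<le> B * lp_norm p c"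
    using inv by (auto simp: lp_invertible_def lp_bounded_def)
  show ?thesis
  proof (intro exI[of _ "1 / (\<bar>B\<bar> + 1)"] conjI ballI)
    fix c :: "'a \<Rightarrow> complex" assume c: "c \<in> lp_space p"
    have Tc: "T c \<in> lp_space p" using bij c by (rule bij_betwE[THEN bspec])
    have "lp_norm p c \<le> B * lp_norm p (T c)"
      using B[OF Tc] bij_betw_inv_into_left[OF bij c] by simp
    also have "\<dots> \<le> (\<bar>B\<bar> + 1) * lp_norm p (T c)"
      by (intro mult_right_mono lp_norm_nonneg p Tc) auto
    finally show "1 / (\<bar>B\<bar> + 1) * lp_norm p c \<le> lp_norm p (T c)"
      by (simp add: field_simps)
  qed simp
qed

text \<open>The columns of \<open>b\<close> are the preimages of the unit vectors. For a unit vector the convolution on the right of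
  the pointwise bound has a single term, so the \<open>r\<close>-th root can be taken without loss.\<close>
lemma inverse_kernel:
  fixes a :: "'i::ab_group_add \<Rightarrow> 'i \<Rightarrow> complex"
  assumes p: "0 < p" and r: "0 < r" and inv: "lp_invertible p (mat_apply a)"
    and dom: "\<And>c k. c \<in> lp_space \<infinity> \<Longrightarrow> norm (c k) powr r \<le> conv v (\<lambda>l. norm (mat_apply a c l) powr r) k"
  shows "\<exists>b. (\<forall>k l. norm (b k l) \<le> v (k - l) powr (1 / r)) \<and>
    (\<forall>k l. (\<Sum>\<^sub>\<infinity>m. a k m * b m l) = (if k = l then 1 else 0))"
proof -
  define \<delta> :: "'i \<Rightarrow> 'i \<Rightarrow> complex" where "\<delta> = (\<lambda>l k. if k = l then 1 else 0)"
  define b where "b = (\<lambda>k l. inv_into (lp_space p) (mat_apply a) (\<delta> l) k)"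
  have bij: "bij_betw (mat_apply a) (lp_space p) (lp_space p)" using inv by (simp add: lp_invertible_def)
  have \<delta>: "\<delta> l \<in> lp_space p" for l
    by (rule lp_mass_finite_support(1)[OF p, of "{l}"]) (auto simp: \<delta>_def)
  have col: "mat_apply a (\<lambda>k. b k l) = \<delta> l" for l
    using bij_betw_inv_into_right[OF bij \<delta>] by (simp add: b_def)
  have mem: "(\<lambda>k. b k l) \<in> lp_space p" for l
    using bij_betwE[OF bij_betw_inv_into[OF bij]] \<delta> by (auto simp: b_def)
  show ?thesis
  proof (intro exI[of _ b] conjI allI)
    fix k l
    show "(\<Sum>\<^sub>\<infinity>m. a k m * b m l) = (if k = l then 1 else 0)"
      using fun_cong[OF col[of l], of k] by (simp add: mat_apply_def \<delta>_def)
    have "((\<lambda>j. v (k - j) * norm (\<delta> l j) powr r) has_sum v (k - l)) UNIV"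
      by (rule has_sum_finite_neutralI[of "{l}"]) (auto simp: \<delta>_def)
    then have "conv v (\<lambda>j. norm (\<delta> l j) powr r) k = v (k - l)"
      by (simp add: conv_flip has_sum_iff)
    then have "norm (b k l) powr r \<le> v (k - l)"
      using dom[OF lp_space_subset_infty[OF p mem[of l]], of k] by (simp add: col)
    then have "(norm (b k l) powr r) powr (1 / r) \<le> v (k - l) powr (1 / r)"
      using r by (intro powr_mono2) auto
    then show "norm (b k l) \<le> v (k - l) powr (1 / r)" using r by (simp add: powr_powr)
  qed
qed

text \<open>Injectivity and the bound on the inverse come from the lower bound, surjectivity from the right inverse
  \<open>b\<close>, which acts on \<open>\<ell>\<^sup>q\<close> since it is itself dominated. Writing down the preimage also works for
  \<open>q = \<infinity>\<close>, where the finitely supported sequences are not dense.\<close>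
lemma lp_invertibleI:
  fixes a b :: "'i::ab_group_add \<Rightarrow> 'i \<Rightarrow> complex"
  assumes p0: "0 < p0" "p0 \<le> 1" and q: "ereal p0 \<le> q"
    and h: "(\<lambda>s. h s powr p0) summable_on UNIV" and a: "\<And>k l. norm (a k l) \<le> h (k - l)"
    and g: "(\<lambda>s. g s powr p0) summable_on UNIV" and b: "\<And>k l. norm (b k l) \<le> g (k - l)"
    and ab: "\<And>k l. (\<Sum>\<^sub>\<infinity>m. a k m * b m l) = (if k = l then 1 else 0)"
    and C: "0 < C" and lower: "\<And>c. c \<in> lp_space q \<Longrightarrow> C * lp_norm q c \<le> lp_norm q (mat_apply a c)"
  shows "lp_invertible q (mat_apply a)"
proof -
  have q0: "0 < q" using p0 q by (metis ereal_less(2) less_le_trans)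
  have h0: "0 \<le> h s" and g0: "0 \<le> g s" for s
    using norm_ge_zero[THEN order_trans, OF a[of s 0]] norm_ge_zero[THEN order_trans, OF b[of s 0]] by auto
  have hsum: "h summable_on UNIV" using summable_on_powr_mono[OF h0 h p0] by (simp add: h0)
  have gsum: "g summable_on UNIV" using summable_on_powr_mono[OF g0 g p0] by (simp add: g0)
  have mem: "mat_apply a c \<in> lp_space q" if "c \<in> lp_space q" for c
    by (rule mat_apply_mem_lp_space[OF p0 q h a that])
  have "inj_on (mat_apply a) (lp_space q)"
  proof (rule inj_onI)
    fix c c' assume c: "c \<in> lp_space q" "c' \<in> lp_space q" and eq: "mat_apply a c = mat_apply a c'"
    define d where "d = (\<lambda>k. c k - c' k)"
    have d: "d \<in> lp_space q"
      by (rule lp_mass_add_le(1)[OF q0 c]) (simp add: d_def norm_triangle_ineq4)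
    have "mat_apply a d k = 0" for k
    proof -
      have s: "(\<lambda>l. a k l * x l) summable_on UNIV" if "x \<in> lp_space q" for x
        by (rule summable_on_mat_apply(2)[OF a hsum lp_space_subset_infty[OF q0 that]])
      have "mat_apply a c k = mat_apply a d k + mat_apply a c' k"
        unfolding mat_apply_def using infsum_add[OF s[OF d] s[OF c(2)]] by (simp add: d_def algebra_simps)
      with eq show ?thesis by simp
    qed
    then have "mat_apply a d = (\<lambda>_. 0)" by auto
    then have "C * lp_norm q d \<le> lp_norm q (\<lambda>_ :: 'i. 0 :: complex)" using lower[OF d] by simp
    also have "\<dots> = 0" by (simp add: lp_norm_def)
    finally have "lp_norm q d = 0" using C lp_norm_nonneg[OF q0 d] by (simp add: mult_le_0_iff)
    then have "norm (d k) powr subexp q \<le> 0" for k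
      using norm_powr_le_lp_mass[OF q0 d, of k] by (simp add: lp_mass_def)
    then show "c = c'" by (auto simp: d_def)
  qed
  moreover have "mat_apply a ` lp_space q = lp_space q"
  proof (intro equalityI subsetI)
    fix f :: "'i \<Rightarrow> complex" assume f: "f \<in> lp_space q"
    obtain M where M: "\<And>l. norm (f l) \<le> M" 
      using lp_space_subset_infty[OF q0 f] by (auto simp: mem_lp_space_infty)
    have "mat_apply a (mat_apply b f) k = f k" for k
    proof -
      have "mat_apply a (mat_apply b f) k = (\<Sum>\<^sub>\<infinity>l. (\<Sum>\<^sub>\<infinity>m. a k m * b m l) * f l)"
        unfolding mat_apply_def by (rule dominated_matrix_assoc[OF a b hsum gsum M])
      also have "((\<lambda>l. (\<Sum>\<^sub>\<infinity>m. a k m * b m l) * f l) has_sum f k) UNIV"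
        unfolding ab by (rule has_sum_finite_neutralI[of "{k}"]) auto
      then have "(\<Sum>\<^sub>\<infinity>l. (\<Sum>\<^sub>\<infinity>m. a k m * b m l) * f l) = f k" by (rule infsumI)
      finally show ?thesis .
    qed
    then have "f = mat_apply a (mat_apply b f)" by auto
    moreover have "mat_apply b f \<in> lp_space q" by (rule mat_apply_mem_lp_space[OF p0 q g b f])
    ultimately show "f \<in> mat_apply a ` lp_space q" by blast
  qed (auto intro: mem)
  ultimately have bij: "bij_betw (mat_apply a) (lp_space q) (lp_space q)" by (simp add: bij_betw_def)
  have inv: "inv_into (lp_space q) (mat_apply a) f \<in> lp_space q" if "f \<in> lp_space q" for f
    using bij_betwE[OF bij_betw_inv_into[OF bij]] that by auto
  have "lp_norm q (inv_into (lp_space q) (mat_apply a) f) \<le> 1 / C * lp_norm q f" if f: "f \<in> lp_space q" for f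
    using lower[OF inv[OF f]] bij_betw_inv_into_right[OF bij f] C by (simp add: field_simps)
  then have "\<exists>D. \<forall>f\<in>lp_space q. lp_norm q (inv_into (lp_space q) (mat_apply a) f) \<le> D * lp_norm q f"
    by blast
  then show ?thesis using bij inv by (simp add: lp_invertible_def lp_bounded_def)
qed

theorem theorem1p3:
  fixes a :: "int ^ 'd \<Rightarrow> int ^ 'd \<Rightarrow> complex"
    and h :: "int ^ 'd \<Rightarrow> real"
    and p0 :: real
  assumes "0 < p0" and "p0 \<le> 1"
    and "h \<in> lp_space (ereal p0)"
    and "\<And>k l. norm (a k l) \<le> h (k - l)"
  shows "(\<forall>p\<in>{ereal p0..\<infinity>}. lp_invertible p (mat_apply a) \<longrightarrow>
            (\<forall>q\<in>{ereal p0..\<infinity>}. lp_invertible q (mat_apply a)))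
       \<and> (\<forall>p\<in>{ereal p0..\<infinity>}.
            (\<exists>C>0. \<forall>c\<in>lp_space p. lp_norm p (mat_apply a c) \<ge> C * lp_norm p c) \<longrightarrow>
            (\<forall>q\<in>{ereal p0..\<infinity>}.
               \<exists>C>0. \<forall>c\<in>lp_space q. lp_norm q (mat_apply a c) \<ge> C * lp_norm q c))"
proof -
  note p0 = assms(1,2) and a = assms(4)
  have h0: "0 \<le> h s" for s using norm_ge_zero[THEN order_trans, OF a[of s 0]] by simp
  have h: "(\<lambda>s. h s powr p0) summable_on UNIV" using assms(3) by (simp add: mem_lp_space_real h0)

  have pointwise: "\<exists>v. (\<forall>k. 0 \<le> v k) \<and> (\<lambda>k. v k powr (p0 / subexp p)) summable_on UNIV \<and>
      (\<forall>c\<in>lp_space \<infinity>. \<forall>k.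
         norm (c k) powr subexp p \<le> conv v (\<lambda>l. norm (mat_apply a c l) powr subexp p) k)"
    if p: "ereal p0 \<le> p" 
      and lower: "\<exists>C>0. \<forall>c\<in>lp_space p. C * lp_norm p c \<le> lp_norm p (mat_apply a c)" for p
    using lower lower_bound_imp_pointwise_bound[OF p0 p h a] by blast

  have stable: "\<exists>C>0. \<forall>c\<in>lp_space q. C * lp_norm q c \<le> lp_norm q (mat_apply a c)"
    if p: "ereal p0 \<le> p" and q: "ereal p0 \<le> q"
      and lower: "\<exists>C>0. \<forall>c\<in>lp_space p. C * lp_norm p c \<le> lp_norm p (mat_apply a c)" for p q
  proof -
    from pointwise[OF p lower] obtain v 
      where v: "\<forall>k. 0 \<le> v k" "(\<lambda>k. v k powr (p0 / subexp p)) summable_on UNIV"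
        and dom: "\<forall>c\<in>lp_space \<infinity>. \<forall>k.
          norm (c k) powr subexp p \<le> conv v (\<lambda>l. norm (mat_apply a c l) powr subexp p) k"
      by blast
    show ?thesis
    proof (rule pointwise_bound_imp_lower_bound[OF p0(1) subexp_ge[OF p0 p] q _ v(2)])
      show "mat_apply a c \<in> lp_space q" if "c \<in> lp_space q" for c
        by (rule mat_apply_mem_lp_space[OF p0 q h a that])
    qed (use v dom in auto)
  qed

  have invariant: "lp_invertible q (mat_apply a)"
    if p: "ereal p0 \<le> p" and q: "ereal p0 \<le> q" and inv: "lp_invertible p (mat_apply a)" for p q
  proof -
    have pp: "0 < p" using p0 p by (metis ereal_less(2) less_le_trans)
    note lower = lp_invertible_imp_lower_bound[OF pp inv]
    from pointwise[OF p lower] obtain v 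
      where v: "\<forall>k. 0 \<le> v k" "(\<lambda>k. v k powr (p0 / subexp p)) summable_on UNIV"
        and dom: "\<forall>c\<in>lp_space \<infinity>. \<forall>k.
          norm (c k) powr subexp p \<le> conv v (\<lambda>l. norm (mat_apply a c l) powr subexp p) k"
      by blast
    from inverse_kernel[OF pp subexp_bounds(1)[OF pp] inv] dom obtain b 
      where b: "\<And>k l. norm (b k l) \<le> v (k - l) powr (1 / subexp p)"
        and ab: "\<And>k l. (\<Sum>\<^sub>\<infinity>m. a k m * b m l) = (if k = l then 1 else 0)"
      by blast
    have g: "(\<lambda>s. (v s powr (1 / subexp p)) powr p0) summable_on UNIV"
      using v(2) by (simp add: powr_powr)
    obtain C where C: "0 < C" "\<And>c. c \<in> lp_space q \<Longrightarrow> C * lp_norm q c \<le> lp_norm q (mat_apply a c)"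
      using stable[OF p q lower] by blast
    show ?thesis by (rule lp_invertibleI[OF p0 q h a g b ab C])
  qed

  show ?thesis using stable invariant by simp
qed

end
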